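(* Let $V=\{(a,b,c,d,e,f,g)^T\in\mathbb{C}^7 : e+f+g-a-b-c-d=1\}$ and for $\vec{x}=(a,b,c,d,e,f,g)^T\in V$ write $K(\vec{x})=K(a;b,c,d;e,f,g)$. Let $Q_6$ denote the group of $6\times 6$ permutation matrices, let $P_{1,6}$ be the group (isomorphic to the symmetric group $S_6$) of all matrices $p\in GL(7,\mathbb{R})$ of the form $$p=\begin{pmatrix}1&0\\0&q\end{pmatrix},\qquad q\in Q_6,$$ and put $$S=\begin{pmatrix}1&0&0&0&0&0&0\\0&0&1&1&0&0&0\\0&1&0&1&0&0&0\\0&1&1&0&0&0&0\\0&1&1&1&1&0&0\\0&1&1&1&0&1&0\\0&1&1&1&0&0&1\end{pmatrix}\in GL(7,\mathbb{R}).$$ Then $K(h\vec{x})=K(\vec{x})$ for every $\vec{x}\in V$ and every $h$ in the group $G_K=\{SpS^{-1} : p\in P_{1,6}\}$, where $h\vec{x}$ denotes matrix multiplication.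
   Context: Notation: $(u)_k=u(u+1)\cdots(u+k-1)$, $(u)_0=1$, and ${}_4F_3(a,b,c,d;e,f,g;1)=\sum_{k\ge0}\frac{(a)_k(b)_k(c)_k(d)_k}{k!\,(e)_k(f)_k(g)_k}$. For complex numbers with $e+f+g-a-b-c-d=1$ define $$K(a;b,c,d;e,f,g)=\frac{{}_4F_3(a,b,c,d;e,f,g;1)}{\Gamma(e)\Gamma(f)\Gamma(g)\Gamma(1+a-e)\Gamma(1+a-f)\Gamma(1+a-g)}+\frac{{}_4F_3(a,1+a-e,1+a-f,1+a-g;1+a-b,1+a-c,1+a-d;1)}{\Gamma(1+a-b)\Gamma(1+a-c)\Gamma(1+a-d)\Gamma(b)\Gamma(c)\Gamma(d)}.$$ Both series converge absolutely; each quotient of the form ${}_4F_3(A,B,C,D;E,F,G;1)/(\Gamma(E)\Gamma(F)\Gamma(G))$ is read as $\sum_{k\ge0}\frac{(A)_k(B)_k(C)_k(D)_k}{k!\,\Gamma(k+E)\Gamma(k+F)\Gamma(k+G)}$ with $1/\Gamma$ entire, so $K$ is defined (and entire) on all of $V$. *)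

theory Defs
  imports "HOL-Analysis.Analysis"
begin

definition hyp4F3 ::
    "complex \<Rightarrow> complex \<Rightarrow> complex \<Rightarrow> complex \<Rightarrow> complex \<Rightarrow> complex \<Rightarrow> complex \<Rightarrow> complex" where
  "hyp4F3 a b c d e f g =
     (\<Sum>k. (pochhammer a k * pochhammer b k * pochhammer c k * pochhammer d k) /
          (fact k * pochhammer e k * pochhammer f k * pochhammer g k))"

(* The quotient 4F3(a,b,c,d;e,f,g;1) / (Gamma(e) Gamma(f) Gamma(g)), extended to lower
   parameters in the nonpositive integers. The library's rGamma is the entire function
   1/Gamma, so the k-th term needs no side condition; see reg_hyp4F3_eq below. *)
definition reg_hyp4F3 ::
    "complex \<Rightarrow> complex \<Rightarrow> complex \<Rightarrow> complex \<Rightarrow> complex \<Rightarrow> complex \<Rightarrow> complex \<Rightarrow> complex" where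
  "reg_hyp4F3 a b c d e f g =
     (\<Sum>k. (pochhammer a k * pochhammer b k * pochhammer c k * pochhammer d k) / fact k *
          (rGamma (of_nat k + e) * rGamma (of_nat k + f) * rGamma (of_nat k + g)))"

lemma reg_hyp4F3_eq:
  assumes "e \<notin> \<int>\<^sub>\<le>\<^sub>0" "f \<notin> \<int>\<^sub>\<le>\<^sub>0" "g \<notin> \<int>\<^sub>\<le>\<^sub>0"
    and "summable (\<lambda>k. (pochhammer a k * pochhammer b k * pochhammer c k * pochhammer d k) /
          (fact k * pochhammer e k * pochhammer f k * pochhammer g k))"
  shows "reg_hyp4F3 a b c d e f g = hyp4F3 a b c d e f g / (Gamma e * Gamma f * Gamma g)"
proof -
  have r: "rGamma (of_nat k + z) = 1 / (Gamma z * pochhammer z k)" if "z \<notin> \<int>\<^sub>\<le>\<^sub>0" for z :: complex and k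
    using that by (simp add: pochhammer_Gamma rGamma_inverse_Gamma add.commute
        Gamma_eq_zero_iff divide_simps)
  show ?thesis
    unfolding reg_hyp4F3_def hyp4F3_def suminf_divide[OF assms(4), symmetric]
    by (intro arg_cong[where f = suminf] ext) (simp add: r assms(1-3) divide_simps)
qed

definition K_fun ::
    "complex \<Rightarrow> complex \<Rightarrow> complex \<Rightarrow> complex \<Rightarrow> complex \<Rightarrow> complex \<Rightarrow> complex \<Rightarrow> complex" where
  "K_fun a b c d e f g =
     reg_hyp4F3 a b c d e f g *
       (rGamma (1 + a - e) * rGamma (1 + a - f) * rGamma (1 + a - g)) +
     reg_hyp4F3 a (1 + a - e) (1 + a - f) (1 + a - g) (1 + a - b) (1 + a - c) (1 + a - d) *
       (rGamma b * rGamma c * rGamma d)"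

(* Vectors (a,b,c,d,e,f,g)^T are indexed by 1, ..., 7. In the finite index type 7 the numerals
   7 and 0 denote the same element; as in vector [...], x$7 is the last coordinate. *)
definition K_vec :: "complex ^ 7 \<Rightarrow> complex" where
  "K_vec x = K_fun (x$1) (x$2) (x$3) (x$4) (x$5) (x$6) (x$7)"

definition V7 :: "(complex ^ 7) set" where
  "V7 = {x. x$5 + x$6 + x$7 - x$1 - x$2 - x$3 - x$4 = 1}"

definition Q6 :: "(real ^ 6 ^ 6) set" where
  "Q6 = {(\<chi> i j. if i = \<sigma> j then 1 else 0) | \<sigma>. \<sigma> permutes UNIV}"

definition block1 :: "real ^ 6 ^ 6 \<Rightarrow> real ^ 7 ^ 7" where
  "block1 q = vector
    [vector [1, 0, 0, 0, 0, 0, 0],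
     vector [0, q$1$1, q$1$2, q$1$3, q$1$4, q$1$5, q$1$6],
     vector [0, q$2$1, q$2$2, q$2$3, q$2$4, q$2$5, q$2$6],
     vector [0, q$3$1, q$3$2, q$3$3, q$3$4, q$3$5, q$3$6],
     vector [0, q$4$1, q$4$2, q$4$3, q$4$4, q$4$5, q$4$6],
     vector [0, q$5$1, q$5$2, q$5$3, q$5$4, q$5$5, q$5$6],
     vector [0, q$6$1, q$6$2, q$6$3, q$6$4, q$6$5, q$6$6]]"

definition P16 :: "(real ^ 7 ^ 7) set" where
  "P16 = {block1 q | q. q \<in> Q6}"

definition S_mat :: "real ^ 7 ^ 7" where
  "S_mat = vector
    [vector [1, 0, 0, 0, 0, 0, 0],
     vector [0, 0, 1, 1, 0, 0, 0],
     vector [0, 1, 0, 1, 0, 0, 0],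
     vector [0, 1, 1, 0, 0, 0, 0],
     vector [0, 1, 1, 1, 1, 0, 0],
     vector [0, 1, 1, 1, 0, 1, 0],
     vector [0, 1, 1, 1, 0, 0, 1]]"

definition G_K :: "(real ^ 7 ^ 7) set" where
  "G_K = {S_mat ** p ** matrix_inv S_mat | p. p \<in> P16}"

definition act :: "real ^ 7 ^ 7 \<Rightarrow> complex ^ 7 \<Rightarrow> complex ^ 7" where
  "act h x = map_matrix complex_of_real h *v x"

end

theory Submission
  imports Defs "HOL-Complex_Analysis.Conformal_Mappings"
begin

text \<open>
  Write \<open>S\<^sup>-\<^sup>1 x = (a, y\<^sub>1, \<dots>, y\<^sub>6)\<close>; on \<open>V\<close> this forces \<open>a = y\<^sub>1 + \<dots> + y\<^sub>6 - 1\<close>, and the claim becomes that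
  \<open>K\<close> is a symmetric function of \<open>y\<^sub>1, \<dots>, y\<^sub>6\<close>. Permutations of \<open>y\<^sub>1, y\<^sub>2, y\<^sub>3\<close> and of
  \<open>y\<^sub>4, y\<^sub>5, y\<^sub>6\<close> only permute the parameters of the two series, so one transposition linking
  the two blocks suffices. For large real \<open>y\<close>, Beta integrals and the binomial series turn the two
  series into integrals over \<open>0 < x < q < p < 1\<close> and over \<open>1 < p < q < x\<close>. Rescaling \<open>p\<close> and \<open>q\<close>
  with \<open>\<bar>1 - x\<bar>\<close> cancels every power of \<open>\<bar>1 - x\<bar>\<close>, precisely because \<open>a = \<Sum>y - 1\<close>, and merges
  both regions into one integral over \<open>x > 0\<close>. A further change of variables writes that integral as
  \<open>\<integral> \<theta>\<^bsup>A\<^esup> (1 - \<theta>)\<^bsup>B\<^esup> F(1 - \<theta>) G(1 - \<theta>) d\<theta>\<close> with two Gauss functions \<open>F\<close>, \<open>G\<close>; interchanging the upper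
  parameters of both swaps \<open>y\<^sub>2\<close> and \<open>y\<^sub>5\<close>. All integrands are nonnegative, so Tonelli
  applies throughout, and the resulting identity extends to complex \<open>y\<close> one variable at a time.
\<close>

subsection \<open>Beta integrals and Euler integrals\<close>

lemma Beta_real_nonneg:
  fixes a b :: real
  assumes "a > 0" "b > 0"
  shows "Beta a b \<ge> 0"
  using assms by (auto simp: Beta_def intro!: divide_nonneg_nonneg mult_nonneg_nonneg Gamma_real_nonneg)

text \<open>The substitution \<open>t = q * u\<close> pulls out the power of \<open>q\<close> and
  leaves the classical Beta integral. The free endpoint \<open>q\<close> is what allows such
  integrals to be nested.\<close>

lemma nn_integral_Beta:
  fixes a b q :: real
  assumes "a > 0" "b > 0" "q > 0"
  shows "(\<integral>\<^sup>+t. ennreal (if 0 < t \<and> t < q then t powr (a - 1) * (q - t) powr (b - 1) else 0) \<partial>lborel)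
           = ennreal (q powr (a + b - 1) * Beta a b)"
proof -
  have "((\<lambda>t. t powr (a - 1) * (1 - t) powr (b - 1)) has_integral Beta a b) {0<..<1}"
    using has_integral_Beta_real[OF assms(1,2)] has_integral_Icc_iff_Ioo by blast
  note lb = nn_integral_has_integral_lebesgue[OF _ this]
  have 1: "(\<integral>\<^sup>+t. ennreal (if 0 < t \<and> t < 1 then t powr (a - 1) * (1 - t) powr (b - 1) else 0) \<partial>lborel)
      = ennreal (Beta a b)"
    by (subst lb[symmetric], simp, intro nn_integral_cong) (auto simp: indicator_def)
  have "(\<integral>\<^sup>+t. ennreal (if 0 < t \<and> t < q then t powr (a - 1) * (q - t) powr (b - 1) else 0) \<partial>lborel)
      = ennreal \<bar>q\<bar> * (\<integral>\<^sup>+t. ennreal (if 0 < 0 + q * t \<and> 0 + q * t < q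
            then (0 + q * t) powr (a - 1) * (q - (0 + q * t)) powr (b - 1) else 0) \<partial>lborel)"
    using assms by (intro nn_integral_real_affine) auto
  also have "\<dots> = ennreal \<bar>q\<bar> * (\<integral>\<^sup>+t. ennreal (q powr (a + b - 2)) *
        ennreal (if 0 < t \<and> t < 1 then t powr (a - 1) * (1 - t) powr (b - 1) else 0) \<partial>lborel)"
  proof (intro arg_cong2[where f = "(*)"] nn_integral_cong refl)
    fix t :: real
    have "(q * t) powr (a - 1) * (q - q * t) powr (b - 1) =
        q powr (a + b - 2) * (t powr (a - 1) * (1 - t) powr (b - 1))" if "0 < t" "t < 1"
    proof -
      have eq: "q - q * t = q * (1 - t)" by algebra
      have e: "q powr (a + b - 2) = q powr (a - 1) * q powr (b - 1)"
        by (subst powr_add[symmetric], rule arg_cong[where f = "\<lambda>e. q powr e"]) simp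
      show ?thesis unfolding eq e using that assms by (simp only: powr_mult mult_ac)
    qed
    then show "ennreal (if 0 < 0 + q * t \<and> 0 + q * t < q
            then (0 + q * t) powr (a - 1) * (q - (0 + q * t)) powr (b - 1) else 0) =
         ennreal (q powr (a + b - 2)) *
        ennreal (if 0 < t \<and> t < 1 then t powr (a - 1) * (1 - t) powr (b - 1) else 0)"
      using assms by (auto simp: ennreal_mult[symmetric] zero_less_mult_iff)
  qed
  also have "\<dots> = ennreal q * (ennreal (q powr (a + b - 2)) * ennreal (Beta a b))"
    using assms by (subst nn_integral_cmult) (auto simp: 1)
  also have "\<dots> = ennreal (q powr (a + b - 1) * Beta a b)"
    using assms Beta_real_nonneg[of a b] powr_mult_base[of q "a + b - 2"]
    by (simp add: ennreal_mult[symmetric] mult.assoc[symmetric])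
  finally show ?thesis .
qed

text \<open>The map \<open>t \<mapsto> 1 / t\<close> carries the Beta integral from
  \<open>(0, 1)\<close> to \<open>(1, \<infinity>)\<close>; scaling by \<open>q\<close> then moves
  the endpoint.\<close>

lemma nn_integral_Beta_at_top:
  fixes a b q :: real
  assumes "a > 0" "b > 0" "q > 0"
  shows "(\<integral>\<^sup>+t. ennreal (if q < t then t powr (- (a + b)) * (t - q) powr (b - 1) else 0) \<partial>lborel)
           = ennreal (q powr (- a) * Beta a b)"
proof -
  let ?f = "\<lambda>t::real. t powr (- (a + b)) * (t - 1) powr (b - 1)"
  have img: "(\<lambda>t::real. 1 / t) ` {0<..<1} = {1<..}"
  proof (intro equalityI subsetI)
    fix x :: real assume "x \<in> {1<..}"
    then show "x \<in> (\<lambda>t::real. 1 / t) ` {0<..<1}"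
      by (intro image_eqI[of _ _ "1 / x"]) auto
  qed auto
  \<comment> \<open>The Jacobian \<open>1 / t^2\<close> and the powers of \<open>t\<close> in
    \<open>?f (1 / t)\<close> combine to the exponent
    \<open>(a + b) - (b - 1) - 2 = a - 1\<close>.\<close>
  have eq: "\<bar>- (1 / t\<^sup>2)\<bar> * ?f (1 / t) = t powr (a - 1) * (1 - t) powr (b - 1)"
    if "t \<in> {0<..<1}" for t
  proof -
    have "1 / t - 1 = (1 - t) / t" using that by (simp add: field_simps)
    moreover have "t powr 2 = t\<^sup>2" using that by (simp add: powr_realpow)
    ultimately show ?thesis using that
      by (simp add: powr_divide powr_minus powr_diff powr_add field_simps power2_eq_square)
  qed
  have B: "((\<lambda>t. t powr (a - 1) * (1 - t) powr (b - 1)) has_integral Beta a b) {0<..<1}"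
    using has_integral_Beta_real[OF assms(1,2)] has_integral_Icc_iff_Ioo by blast
  then have "(\<lambda>t. t powr (a - 1) * (1 - t) powr (b - 1)) absolutely_integrable_on {0<..<1} \<and>
      integral {0<..<1} (\<lambda>t. t powr (a - 1) * (1 - t) powr (b - 1)) = Beta a b"
    by (auto intro!: nonnegative_absolutely_integrable_1 simp: integral_unique)
  then have "(\<lambda>t. \<bar>- (1 / t\<^sup>2)\<bar> * ?f (1 / t)) absolutely_integrable_on {0<..<1} \<and>
      integral {0<..<1} (\<lambda>t. \<bar>- (1 / t\<^sup>2)\<bar> * ?f (1 / t)) = Beta a b"
    using eq by (metis (mono_tags, lifting) integral_cong set_integrable_cong)
  then have "?f absolutely_integrable_on ((\<lambda>t::real. 1 / t) ` {0<..<1}) \<and>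
      integral ((\<lambda>t::real. 1 / t) ` {0<..<1}) ?f = Beta a b"
    by (subst (asm) has_absolute_integral_change_of_variables_1')
       (auto intro!: derivative_eq_intros simp: inj_on_def power2_eq_square field_simps)
  then have "(?f has_integral Beta a b) {1<..}"
    unfolding img by (metis has_integral_integrable_integral set_lebesgue_integral_eq_integral(1))
  note lb = nn_integral_has_integral_lebesgue[OF _ this]
  have 1: "(\<integral>\<^sup>+t. ennreal (if 1 < t then ?f t else 0) \<partial>lborel) = ennreal (Beta a b)"
    by (subst lb[symmetric], simp, intro nn_integral_cong) (auto simp: indicator_def)
  have "(\<integral>\<^sup>+t. ennreal (if q < t then t powr (- (a + b)) * (t - q) powr (b - 1) else 0) \<partial>lborel)
      = ennreal \<bar>q\<bar> * (\<integral>\<^sup>+t. ennreal (if q < 0 + q * t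
            then (0 + q * t) powr (- (a + b)) * (0 + q * t - q) powr (b - 1) else 0) \<partial>lborel)"
    using assms by (intro nn_integral_real_affine) auto
  also have "\<dots> = ennreal \<bar>q\<bar> * (\<integral>\<^sup>+t. ennreal (q powr (- a - 1)) *
        ennreal (if 1 < t then ?f t else 0) \<partial>lborel)"
  proof (intro arg_cong2[where f = "(*)"] nn_integral_cong refl)
    fix t :: real
    have "(q * t) powr (- (a + b)) * (q * t - q) powr (b - 1) = q powr (- a - 1) * ?f t" if "1 < t"
    proof -
      have eq: "q * t - q = q * (t - 1)" by algebra
      have e: "q powr (- a - 1) = q powr (- (a + b)) * q powr (b - 1)"
        by (subst powr_add[symmetric], rule arg_cong[where f = "\<lambda>e. q powr e"]) simp
      show ?thesis unfolding eq e using that assms by (simp only: powr_mult mult_ac)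
    qed
    then show "ennreal (if q < 0 + q * t
            then (0 + q * t) powr (- (a + b)) * (0 + q * t - q) powr (b - 1) else 0) =
         ennreal (q powr (- a - 1)) * ennreal (if 1 < t then ?f t else 0)"
      using assms by (auto simp: ennreal_mult[symmetric])
  qed
  also have "\<dots> = ennreal q * (ennreal (q powr (- a - 1)) * ennreal (Beta a b))"
    using assms by (subst nn_integral_cmult) (auto simp: 1)
  also have "\<dots> = ennreal (q powr (- a) * Beta a b)"
    using assms Beta_real_nonneg[of a b] powr_mult_base[of q "- a - 1"]
    by (simp add: ennreal_mult[symmetric] mult.assoc[symmetric])
  finally show ?thesis .
qed

text \<open>Newton's binomial series at \<open>- z\<close>, since
  \<open>((- a) gchoose m) * (- 1) ^ m\<close> is \<open>pochhammer a m / fact m\<close>. For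
  \<open>a > 0\<close> and \<open>z \<ge> 0\<close> all terms are nonnegative, so the sum may be
  taken in \<open>ennreal\<close>.\<close>

lemma binomial_series_ennreal:
  fixes a z :: real
  assumes "a > 0" "0 \<le> z" "z < 1"
  shows "ennreal ((1 - z) powr (- a)) = (\<Sum>m. ennreal (pochhammer a m / fact m * z ^ m))"
proof -
  have "(\<lambda>m. ((- a) gchoose m) * (- z) ^ m) sums (1 + (- z)) powr (- a)"
    using assms by (intro gen_binomial_real) auto
  also have "(\<lambda>m. ((- a) gchoose m) * (- z) ^ m) = (\<lambda>m. pochhammer a m / fact m * z ^ m)"
    by (auto simp: gbinomial_pochhammer power_mult_distrib[symmetric] simp flip: power_mult_distrib)
  finally have "(\<lambda>m. pochhammer a m / fact m * z ^ m) sums (1 - z) powr (- a)" by simp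
  then show ?thesis using assms
    by (subst suminf_ennreal2) (auto simp: sums_iff intro!: mult_nonneg_nonneg divide_nonneg_pos pochhammer_nonneg)
qed

text \<open>Equals \<open>Beta b c\<close> times the Gauss function with upper parameters \<open>a\<close>, \<open>b\<close> and lower parameter \<open>b + c\<close>.\<close>

definition euler_series :: "real \<Rightarrow> real \<Rightarrow> real \<Rightarrow> real \<Rightarrow> ennreal" where
  "euler_series a b c z = (\<Sum>m. ennreal (pochhammer a m / fact m * z ^ m * Beta (b + real m) c))"

text \<open>Euler's integral: expand \<open>(1 - z * r) powr (- a)\<close> in powers of
  \<open>z * r\<close> and integrate termwise by monotone convergence. Term \<open>m\<close> is a
  Beta integral with \<open>b\<close> raised to \<open>b + m\<close>.\<close>

lemma nn_integral_euler_series: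
  fixes a b c z :: real
  assumes "a > 0" "b > 0" "c > 0" "0 \<le> z" "z < 1"
  shows "(\<integral>\<^sup>+r. ennreal (if 0 < r \<and> r < 1
            then r powr (b - 1) * (1 - r) powr (c - 1) * (1 - z * r) powr (- a) else 0) \<partial>lborel)
         = euler_series a b c z"
proof -
  have "ennreal (if 0 < r \<and> r < 1
            then r powr (b - 1) * (1 - r) powr (c - 1) * (1 - z * r) powr (- a) else 0) =
        (\<Sum>m. ennreal (pochhammer a m / fact m * z ^ m) * ennreal (if 0 < r \<and> r < 1
            then r powr (b + real m - 1) * (1 - r) powr (c - 1) else 0))" for r
  proof (cases "0 < r \<and> r < 1")
    case True
    then have "z * r \<ge> 0" "z * r < 1"
      using assms mult_strict_mono'[of z 1 r 1] by auto
    then have "ennreal (r powr (b - 1) * (1 - r) powr (c - 1) * (1 - z * r) powr (- a))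
      = ennreal (r powr (b - 1) * (1 - r) powr (c - 1)) *
        (\<Sum>m. ennreal (pochhammer a m / fact m * (z * r) ^ m))"
      using assms by (subst binomial_series_ennreal[symmetric]) (auto simp: ennreal_mult)
    also have "\<dots> = (\<Sum>m. ennreal (r powr (b - 1) * (1 - r) powr (c - 1)) *
        ennreal (pochhammer a m / fact m * (z * r) ^ m))" by simp
    also have "\<dots> = (\<Sum>m. ennreal (pochhammer a m / fact m * z ^ m) *
        ennreal (r powr (b + real m - 1) * (1 - r) powr (c - 1)))"
    proof (intro arg_cong[of _ _ suminf] ext)
      fix m
      have "pochhammer a m / fact m \<ge> 0" using assms by (intro divide_nonneg_pos pochhammer_nonneg) auto
      moreover have "r powr (b + real m - 1) = r powr (b - 1) * r ^ m"
        using True by (simp add: powr_realpow powr_add powr_diff field_simps)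
      moreover have "ennreal (r powr (b - 1) * (1 - r) powr (c - 1)) * ennreal (P * (z * r) ^ m) =
         ennreal (P * z ^ m) * ennreal (r ^ m * r powr (b - 1) * (1 - r) powr (c - 1))"
        if "P \<ge> 0" for P
        using that assms True by (simp add: ennreal_mult[symmetric] power_mult_distrib mult_ac)
      ultimately show "ennreal (r powr (b - 1) * (1 - r) powr (c - 1)) *
         ennreal (pochhammer a m / fact m * (z * r) ^ m) =
         ennreal (pochhammer a m / fact m * z ^ m) *
         ennreal (r powr (b + real m - 1) * (1 - r) powr (c - 1))"
        by (metis mult.commute)
    qed
    finally show ?thesis using True by simp
  qed auto
  then have "(\<integral>\<^sup>+r. ennreal (if 0 < r \<and> r < 1
            then r powr (b - 1) * (1 - r) powr (c - 1) * (1 - z * r) powr (- a) else 0) \<partial>lborel)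
    = (\<Sum>m. \<integral>\<^sup>+r. ennreal (pochhammer a m / fact m * z ^ m) * ennreal (if 0 < r \<and> r < 1
            then r powr (b + real m - 1) * (1 - r) powr (c - 1) else 0) \<partial>lborel)"
    by (simp only:) (intro nn_integral_suminf, measurable)
  also have "\<dots> = (\<Sum>m. ennreal (pochhammer a m / fact m * z ^ m) * ennreal (Beta (b + real m) c))"
    using assms by (intro arg_cong[of _ _ suminf] ext, subst nn_integral_cmult)
      (auto simp: nn_integral_Beta)
  also have "\<dots> = euler_series a b c z"
    unfolding euler_series_def using assms
    by (intro arg_cong[of _ _ suminf] ext, subst ennreal_mult)
      (auto intro!: mult_nonneg_nonneg divide_nonneg_pos pochhammer_nonneg Beta_real_nonneg)
  finally show ?thesis .
qed

text \<open>Euler's integral on the half line. With \<open>r = x / (1 + x)\<close> one has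
  \<open>1 + (1 - z) * x = (1 + x) * (1 - z * r)\<close>, so the binomial series applies, and term
  \<open>m\<close> is a Beta integral over \<open>(1, \<infinity>)\<close> in the variable
  \<open>1 + x\<close>.\<close>

lemma nn_integral_euler_series_at_top:
  fixes a b c z :: real
  assumes "a > 0" "b > 0" "c > 0" "0 \<le> z" "z < 1"
  shows "(\<integral>\<^sup>+x. ennreal (if 0 < x
            then x powr (b - 1) * (1 + x) powr (a - b - c) * (1 + (1 - z) * x) powr (- a) else 0) \<partial>lborel)
         = euler_series a b c z"
proof -
  have "ennreal (if 0 < x
            then x powr (b - 1) * (1 + x) powr (a - b - c) * (1 + (1 - z) * x) powr (- a) else 0) =
        (\<Sum>m. ennreal (pochhammer a m / fact m * z ^ m) * ennreal (if 0 < x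
            then (1 + x) powr (- (c + (b + real m))) * (1 + x - 1) powr (b + real m - 1) else 0))" for x
  proof (cases "0 < x")
    case True
    define r where "r = x / (1 + x)"
    have r: "0 < r" "r < 1" "1 + (1 - z) * x = (1 + x) * (1 - z * r)"
      using True by (auto simp: r_def field_simps)
    then have zr: "z * r \<ge> 0" "z * r < 1"
      using assms mult_strict_mono'[of z 1 r 1] by auto
    have e1: "(1 + (1 - z) * x) powr (- a) = (1 + x) powr (- a) * (1 - z * r) powr (- a)"
      unfolding r using True zr by (subst powr_mult) auto
    \<comment> \<open>The power of \<open>1 + x\<close> split off from the last factor cancels the
      \<open>a\<close> in the exponent \<open>a - b - c\<close>, which leaves a Beta
      integrand.\<close>
    have e2: "(1 + x) powr (- b - c) = (1 + x) powr (a - b - c) * (1 + x) powr (- a)"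
      by (subst powr_add[symmetric], rule arg_cong[where f = "\<lambda>e. (1 + x) powr e"]) simp
    have "ennreal (x powr (b - 1) * (1 + x) powr (a - b - c) * (1 + (1 - z) * x) powr (- a))
      = ennreal (x powr (b - 1) * (1 + x) powr (- b - c)) * ennreal ((1 - z * r) powr (- a))"
      unfolding e1 e2 using True by (subst ennreal_mult[symmetric]) (simp_all add: mult_ac)
    also have "\<dots> = (\<Sum>m. ennreal (x powr (b - 1) * (1 + x) powr (- b - c)) *
        ennreal (pochhammer a m / fact m * (z * r) ^ m))"
      using assms zr by (subst binomial_series_ennreal) auto
    also have "\<dots> = (\<Sum>m. ennreal (pochhammer a m / fact m * z ^ m) *
        ennreal ((1 + x) powr (- (c + (b + real m))) * x powr (b + real m - 1)))"
    proof (intro arg_cong[of _ _ suminf] ext)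
      fix m
      have "pochhammer a m / fact m \<ge> 0" using assms by (intro divide_nonneg_pos pochhammer_nonneg) auto
      moreover have "(1 + x) powr (- (c + (b + real m))) * x powr (b + real m - 1)
          = x powr (b - 1) * (1 + x) powr (- b - c) * r ^ m"
        using True by (simp add: r_def powr_realpow powr_add powr_diff powr_minus field_simps)
      moreover have "ennreal (x powr (b - 1) * (1 + x) powr (- b - c)) * ennreal (P * (z * r) ^ m) =
         ennreal (P * z ^ m) * ennreal (x powr (b - 1) * (1 + x) powr (- b - c) * r ^ m)"
        if "P \<ge> 0" for P
        using that assms True r by (simp add: ennreal_mult[symmetric] power_mult_distrib mult_ac)
      ultimately show "ennreal (x powr (b - 1) * (1 + x) powr (- b - c)) *
         ennreal (pochhammer a m / fact m * (z * r) ^ m) =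
         ennreal (pochhammer a m / fact m * z ^ m) *
        ennreal ((1 + x) powr (- (c + (b + real m))) * x powr (b + real m - 1))"
        by metis
    qed
    finally show ?thesis using True by simp
  qed auto
  then have "(\<integral>\<^sup>+x. ennreal (if 0 < x
            then x powr (b - 1) * (1 + x) powr (a - b - c) * (1 + (1 - z) * x) powr (- a) else 0) \<partial>lborel)
    = (\<Sum>m. \<integral>\<^sup>+x. ennreal (pochhammer a m / fact m * z ^ m) * ennreal (if 0 < x
            then (1 + x) powr (- (c + (b + real m))) * (1 + x - 1) powr (b + real m - 1) else 0) \<partial>lborel)"
    by (simp only:) (intro nn_integral_suminf, measurable)
  also have "\<dots> = (\<Sum>m. ennreal (pochhammer a m / fact m * z ^ m) * ennreal (Beta (b + real m) c))"
  proof (intro arg_cong[of _ _ suminf] ext)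
    fix m
    let ?F = "\<lambda>t. ennreal (if 1 < t
            then t powr (- (c + (b + real m))) * (t - 1) powr (b + real m - 1) else 0)"
    have "ennreal (Beta c (b + real m)) = integral\<^sup>N lborel ?F"
      using assms by (subst nn_integral_Beta_at_top) auto
    also have "\<dots> = ennreal \<bar>1\<bar> * (\<integral>\<^sup>+x. ?F (1 + 1 * x) \<partial>lborel)"
      by (intro nn_integral_real_affine) auto
    finally have "(\<integral>\<^sup>+x. ennreal (if 0 < x
            then (1 + x) powr (- (c + (b + real m))) * (1 + x - 1) powr (b + real m - 1) else 0) \<partial>lborel)
       = ennreal (Beta (b + real m) c)"
      by (simp add: Beta_commute cong: if_cong)
    then show "(\<integral>\<^sup>+x. ennreal (pochhammer a m / fact m * z ^ m) * ennreal (if 0 < x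
            then (1 + x) powr (- (c + (b + real m))) * (1 + x - 1) powr (b + real m - 1) else 0) \<partial>lborel)
       = ennreal (pochhammer a m / fact m * z ^ m) * ennreal (Beta (b + real m) c)"
      by (subst nn_integral_cmult) auto
  qed
  also have "\<dots> = euler_series a b c z"
    unfolding euler_series_def using assms
    by (intro arg_cong[of _ _ suminf] ext, subst ennreal_mult)
      (auto intro!: mult_nonneg_nonneg divide_nonneg_pos pochhammer_nonneg Beta_real_nonneg)
  finally show ?thesis .
qed

text \<open>Symmetry of the Gauss function in its upper parameters; the third argument
  \<open>b + c - a\<close> keeps the lower parameter \<open>b + c\<close> fixed. On both sides the
  coefficient of \<open>z ^ m\<close> is \<open>Gamma c * Gamma (b + c - a) * Gamma (a + m) * Gamma
  (b + m) / (fact m * Gamma (b + c + m))\<close>.\<close>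

lemma euler_series_swap:
  fixes a b c z :: real
  assumes "a > 0" "b > 0" "c > 0" "b + c - a > 0" "z \<ge> 0"
  shows "ennreal (Gamma a * Gamma (b + c - a)) * euler_series a b c z =
         ennreal (Gamma b * Gamma c) * euler_series b a (b + c - a) z"
proof -
  have poch: "pochhammer x m = Gamma (x + real m) / Gamma x" if "x > 0" for x :: real and m
    using that by (intro pochhammer_Gamma) (auto elim!: nonpos_Ints_cases)
  have G: "Gamma x > 0" "Gamma x \<noteq> 0" if "x > 0" for x :: real
    using Gamma_real_pos[OF that] by auto
  have *: "ennreal u * euler_series x y w z =
      (\<Sum>m. ennreal (u * (pochhammer x m / fact m * z ^ m * Beta (y + real m) w)))"
    if "x > 0" "y > 0" "w > 0" "u \<ge> 0" for u x y w
    unfolding euler_series_def ennreal_suminf_cmult[symmetric]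
    using that assms by (intro arg_cong[of _ _ suminf] ext, subst ennreal_mult)
      (auto intro!: mult_nonneg_nonneg divide_nonneg_pos pochhammer_nonneg Beta_real_nonneg)
  show ?thesis using assms
    by (subst (1 2) *)
      (auto simp: Gamma_real_nonneg poch Beta_def G field_simps intro!: arg_cong[of _ _ suminf] ext arg_cong[of _ _ ennreal])
qed

text \<open>Integration proceeds from the inside out. The \<open>x\<close>-integral over
  \<open>(0, q)\<close> leaves \<open>q powr (b3 + a3 - 1)\<close>, which the factor
  \<open>q powr (b2 - b3 - a3)\<close> turns into \<open>q powr (b2 - 1)\<close>, the start of the
  next Beta integral; the powers of \<open>p\<close> fit together in the same way.\<close>

lemma nn_integral_Beta_chain:
  fixes a1 a2 a3 b1 b2 b3 :: real
  assumes "a1 > 0" "a2 > 0" "a3 > 0" "b1 > 0" "b2 > 0" "b3 > 0"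
  shows "(\<integral>\<^sup>+p. \<integral>\<^sup>+q. \<integral>\<^sup>+x. ennreal (if 0 < x \<and> x < q \<and> q < p \<and> p < 1 then
            x powr (b3 - 1) * (q - x) powr (a3 - 1) * (q powr (b2 - b3 - a3) * (p - q) powr (a2 - 1)) *
            (p powr (b1 - b2 - a2) * (1 - p) powr (a1 - 1)) else 0) \<partial>lborel \<partial>lborel \<partial>lborel) =
         ennreal (Beta b3 a3 * Beta b2 a2 * Beta b1 a1)"
proof -
  note B = Beta_real_nonneg
  have x: "(\<integral>\<^sup>+x. ennreal (if 0 < x \<and> x < q \<and> q < p \<and> p < 1 then
            x powr (b3 - 1) * (q - x) powr (a3 - 1) * (q powr (b2 - b3 - a3) * (p - q) powr (a2 - 1)) *
            (p powr (b1 - b2 - a2) * (1 - p) powr (a1 - 1)) else 0) \<partial>lborel) =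
      ennreal (if 0 < q \<and> q < p \<and> p < 1 then
            Beta b3 a3 * (q powr (b2 - 1) * (p - q) powr (a2 - 1)) *
            (p powr (b1 - b2 - a2) * (1 - p) powr (a1 - 1)) else 0)" (is "?l = _") for q p
  proof (cases "0 < q \<and> q < p \<and> p < 1")
    case True
    let ?C = "(q powr (b2 - b3 - a3) * (p - q) powr (a2 - 1)) *
            (p powr (b1 - b2 - a2) * (1 - p) powr (a1 - 1))"
    have e: "q powr (b3 + a3 - 1) * q powr (b2 - b3 - a3) = q powr (b2 - 1)"
      by (subst powr_add[symmetric], rule arg_cong[where f = "\<lambda>e. q powr e"]) simp
    have "?l = (\<integral>\<^sup>+x. ennreal ?C *
        ennreal (if 0 < x \<and> x < q then x powr (b3 - 1) * (q - x) powr (a3 - 1) else 0) \<partial>lborel)"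
      using True by (intro nn_integral_cong) (auto simp: ennreal_mult[symmetric] mult_ac)
    also have "\<dots> = ennreal ?C * ennreal (q powr (b3 + a3 - 1) * Beta b3 a3)"
      using True assms by (subst nn_integral_cmult) (auto simp: nn_integral_Beta)
    finally show ?thesis
      using True assms B by (simp add: ennreal_mult[symmetric] e[symmetric] mult_ac)
  next
    case False
    then have "?l = (\<integral>\<^sup>+x. 0 \<partial>(lborel :: real measure))" by (intro nn_integral_cong) auto
    then show ?thesis using False by auto
  qed
  have q: "(\<integral>\<^sup>+q. ennreal (if 0 < q \<and> q < p \<and> p < 1 then
            Beta b3 a3 * (q powr (b2 - 1) * (p - q) powr (a2 - 1)) *
            (p powr (b1 - b2 - a2) * (1 - p) powr (a1 - 1)) else 0) \<partial>lborel) =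
      ennreal (Beta b3 a3 * Beta b2 a2) *
      ennreal (if 0 < p \<and> p < 1 then p powr (b1 - 1) * (1 - p) powr (a1 - 1) else 0)" (is "?l = _") for p
  proof (cases "0 < p \<and> p < 1")
    case True
    let ?C = "Beta b3 a3 * (p powr (b1 - b2 - a2) * (1 - p) powr (a1 - 1))"
    have e: "p powr (b2 + a2 - 1) * p powr (b1 - b2 - a2) = p powr (b1 - 1)"
      by (subst powr_add[symmetric], rule arg_cong[where f = "\<lambda>e. p powr e"]) simp
    have "?l = (\<integral>\<^sup>+q. ennreal ?C *
        ennreal (if 0 < q \<and> q < p then q powr (b2 - 1) * (p - q) powr (a2 - 1) else 0) \<partial>lborel)"
      using True assms B by (intro nn_integral_cong) (auto simp: ennreal_mult[symmetric] mult_ac)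
    also have "\<dots> = ennreal ?C * ennreal (p powr (b2 + a2 - 1) * Beta b2 a2)"
      using True assms by (subst nn_integral_cmult) (auto simp: nn_integral_Beta)
    finally show ?thesis
      using True assms B by (simp add: ennreal_mult[symmetric] e[symmetric] mult_ac)
  next
    case False
    then have "?l = (\<integral>\<^sup>+q. 0 \<partial>(lborel :: real measure))" by (intro nn_integral_cong) auto
    then show ?thesis using False by auto
  qed
  show ?thesis unfolding x q using assms B nn_integral_Beta[of b1 a1 1]
    by (subst nn_integral_cmult) (auto simp: ennreal_mult[symmetric])
qed

text \<open>The same telescoping towards infinity: the \<open>x\<close>-integral over
  \<open>(q, \<infinity>)\<close> leaves \<open>q powr (- b3)\<close>, and the given power of
  \<open>q\<close> completes it to \<open>q powr (- (b2 + a2))\<close>.\<close>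

lemma nn_integral_Beta_chain_at_top:
  fixes a1 a2 a3 b1 b2 b3 :: real
  assumes "a1 > 0" "a2 > 0" "a3 > 0" "b1 > 0" "b2 > 0" "b3 > 0"
  shows "(\<integral>\<^sup>+p. \<integral>\<^sup>+q. \<integral>\<^sup>+x. ennreal (if 1 < p \<and> p < q \<and> q < x then
            x powr (- (b3 + a3)) * (x - q) powr (a3 - 1) * (q powr (b3 - b2 - a2) * (q - p) powr (a2 - 1)) *
            (p powr (b2 - b1 - a1) * (p - 1) powr (a1 - 1)) else 0) \<partial>lborel \<partial>lborel \<partial>lborel) =
         ennreal (Beta b3 a3 * Beta b2 a2 * Beta b1 a1)"
proof -
  note B = Beta_real_nonneg
  have x: "(\<integral>\<^sup>+x. ennreal (if 1 < p \<and> p < q \<and> q < x then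
            x powr (- (b3 + a3)) * (x - q) powr (a3 - 1) * (q powr (b3 - b2 - a2) * (q - p) powr (a2 - 1)) *
            (p powr (b2 - b1 - a1) * (p - 1) powr (a1 - 1)) else 0) \<partial>lborel) =
      ennreal (if 1 < p \<and> p < q then
            Beta b3 a3 * (q powr (- (b2 + a2)) * (q - p) powr (a2 - 1)) *
            (p powr (b2 - b1 - a1) * (p - 1) powr (a1 - 1)) else 0)" (is "?l = _") for q p
  proof (cases "1 < p \<and> p < q")
    case True
    let ?C = "(q powr (b3 - b2 - a2) * (q - p) powr (a2 - 1)) *
            (p powr (b2 - b1 - a1) * (p - 1) powr (a1 - 1))"
    have e: "q powr (- b3) * q powr (b3 - b2 - a2) = q powr (- (b2 + a2))"
      by (subst powr_add[symmetric], rule arg_cong[where f = "\<lambda>e. q powr e"]) simp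
    have "?l = (\<integral>\<^sup>+x. ennreal ?C *
        ennreal (if q < x then x powr (- (b3 + a3)) * (x - q) powr (a3 - 1) else 0) \<partial>lborel)"
      using True by (intro nn_integral_cong) (auto simp: ennreal_mult[symmetric] mult_ac)
    also have "\<dots> = ennreal ?C * ennreal (q powr (- b3) * Beta b3 a3)"
      using True assms by (subst nn_integral_cmult) (auto simp: nn_integral_Beta_at_top simp del: minus_add_distrib)
    finally show ?thesis
      using True assms B by (simp add: ennreal_mult[symmetric] e[symmetric] mult_ac del: minus_add_distrib)
  next
    case False
    then have "?l = (\<integral>\<^sup>+x. 0 \<partial>(lborel :: real measure))" by (intro nn_integral_cong) auto
    then show ?thesis using False by auto
  qed
  have q: "(\<integral>\<^sup>+q. ennreal (if 1 < p \<and> p < q then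
            Beta b3 a3 * (q powr (- (b2 + a2)) * (q - p) powr (a2 - 1)) *
            (p powr (b2 - b1 - a1) * (p - 1) powr (a1 - 1)) else 0) \<partial>lborel) =
      ennreal (Beta b3 a3 * Beta b2 a2) *
      ennreal (if 1 < p then p powr (- (b1 + a1)) * (p - 1) powr (a1 - 1) else 0)" (is "?l = _") for p
  proof (cases "1 < p")
    case True
    let ?C = "Beta b3 a3 * (p powr (b2 - b1 - a1) * (p - 1) powr (a1 - 1))"
    have e: "p powr (- b2) * p powr (b2 - b1 - a1) = p powr (- (b1 + a1))"
      by (subst powr_add[symmetric], rule arg_cong[where f = "\<lambda>e. p powr e"]) simp
    have "?l = (\<integral>\<^sup>+q. ennreal ?C *
        ennreal (if p < q then q powr (- (b2 + a2)) * (q - p) powr (a2 - 1) else 0) \<partial>lborel)"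
      using True assms B by (intro nn_integral_cong) (auto simp: ennreal_mult[symmetric] mult_ac)
    also have "\<dots> = ennreal ?C * ennreal (p powr (- b2) * Beta b2 a2)"
      using True assms by (subst nn_integral_cmult) (auto simp: nn_integral_Beta_at_top simp del: minus_add_distrib)
    finally show ?thesis
      using True assms B by (simp add: ennreal_mult[symmetric] e[symmetric] mult_ac del: minus_add_distrib)
  next
    case False
    then have "?l = (\<integral>\<^sup>+q. 0 \<partial>(lborel :: real measure))" by (intro nn_integral_cong) auto
    then show ?thesis using False by auto
  qed
  show ?thesis unfolding x q using assms B nn_integral_Beta_at_top[of b1 a1 1]
    by (subst nn_integral_cmult) (auto simp: ennreal_mult[symmetric] simp del: minus_add_distrib)
qed

subsection \<open>The triple integral and its symmetry\<close>

lemma measurable_triple: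
  fixes f :: "real \<Rightarrow> real \<Rightarrow> real \<Rightarrow> ennreal"
  assumes f: "(\<lambda>(x, y, z). f x y z) \<in> borel_measurable (lborel \<Otimes>\<^sub>M lborel \<Otimes>\<^sub>M lborel)"
    and [measurable]: "g \<in> borel_measurable M" "h \<in> borel_measurable M" "k \<in> borel_measurable M"
  shows "(\<lambda>w. f (g w) (h w) (k w)) \<in> borel_measurable M"
proof -
  have "(\<lambda>w. (g w, h w, k w)) \<in> M \<rightarrow>\<^sub>M lborel \<Otimes>\<^sub>M lborel \<Otimes>\<^sub>M lborel" by measurable
  from measurable_compose[OF this f] show ?thesis by simp
qed

lemma nn_integral_swap12:
  fixes f :: "real \<Rightarrow> real \<Rightarrow> real \<Rightarrow> ennreal"
  assumes f: "(\<lambda>(x, y, z). f x y z) \<in> borel_measurable (lborel \<Otimes>\<^sub>M lborel \<Otimes>\<^sub>M lborel)"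
  shows "(\<integral>\<^sup>+x. \<integral>\<^sup>+y. \<integral>\<^sup>+z. f x y z \<partial>lborel \<partial>lborel \<partial>lborel) =
         (\<integral>\<^sup>+y. \<integral>\<^sup>+x. \<integral>\<^sup>+z. f x y z \<partial>lborel \<partial>lborel \<partial>lborel)"
proof -
  note [measurable] = measurable_triple[OF f]
  have "(\<lambda>(y, x). \<integral>\<^sup>+z. f x y z \<partial>lborel) \<in> borel_measurable (lborel \<Otimes>\<^sub>M lborel)"
    by measurable
  from lborel_pair.Fubini'[OF this] show ?thesis by simp
qed

lemma nn_integral_swap23:
  fixes f :: "real \<Rightarrow> real \<Rightarrow> real \<Rightarrow> ennreal"
  assumes f: "(\<lambda>(x, y, z). f x y z) \<in> borel_measurable (lborel \<Otimes>\<^sub>M lborel \<Otimes>\<^sub>M lborel)"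
  shows "(\<integral>\<^sup>+x. \<integral>\<^sup>+y. \<integral>\<^sup>+z. f x y z \<partial>lborel \<partial>lborel \<partial>lborel) =
         (\<integral>\<^sup>+x. \<integral>\<^sup>+z. \<integral>\<^sup>+y. f x y z \<partial>lborel \<partial>lborel \<partial>lborel)"
proof (rule nn_integral_cong)
  fix x :: real
  note [measurable] = measurable_triple[OF f]
  have "(\<lambda>(z, y). f x y z) \<in> borel_measurable (lborel \<Otimes>\<^sub>M lborel)"
    by measurable
  from lborel_pair.Fubini'[OF this]
  show "(\<integral>\<^sup>+y. \<integral>\<^sup>+z. f x y z \<partial>lborel \<partial>lborel) = (\<integral>\<^sup>+z. \<integral>\<^sup>+y. f x y z \<partial>lborel \<partial>lborel)" by simp
qed

lemma nn_integral_suminf_cmult3: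
  fixes f :: "nat \<Rightarrow> real \<Rightarrow> real \<Rightarrow> real \<Rightarrow> ennreal"
  assumes f: "\<And>k. (\<lambda>(x, y, z). f k x y z) \<in> borel_measurable (lborel \<Otimes>\<^sub>M lborel \<Otimes>\<^sub>M lborel)"
  shows "(\<integral>\<^sup>+x. \<integral>\<^sup>+y. \<integral>\<^sup>+z. (\<Sum>k. c k * f k x y z) \<partial>lborel \<partial>lborel \<partial>lborel) =
         (\<Sum>k. c k * (\<integral>\<^sup>+x. \<integral>\<^sup>+y. \<integral>\<^sup>+z. f k x y z \<partial>lborel \<partial>lborel \<partial>lborel))"
proof -
  note [measurable] = measurable_triple[OF f]
  have z: "(\<integral>\<^sup>+z. (\<Sum>k. c k * f k x y z) \<partial>lborel) = (\<Sum>k. c k * (\<integral>\<^sup>+z. f k x y z \<partial>lborel))" for x y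
    by (subst nn_integral_suminf, measurable) (simp add: nn_integral_cmult)
  have y: "(\<integral>\<^sup>+y. (\<Sum>k. c k * (\<integral>\<^sup>+z. f k x y z \<partial>lborel)) \<partial>lborel) =
        (\<Sum>k. c k * (\<integral>\<^sup>+y. \<integral>\<^sup>+z. f k x y z \<partial>lborel \<partial>lborel))" for x
    by (subst nn_integral_suminf, measurable) (simp add: nn_integral_cmult)
  show ?thesis unfolding z y
    by (subst nn_integral_suminf, measurable) (simp add: nn_integral_cmult)
qed

text \<open>The variables \<open>s\<close> and \<open>r\<close> are the rescaled \<open>p\<close>
  and \<open>q\<close>: the two bases with negative exponents are \<open>p = 1 + (x - 1) * s\<close>
  and \<open>q = 1 + (x - 1) * r\<close>. In this form one formula covers both \<open>x < 1\<close>
  and \<open>x > 1\<close>.\<close>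

definition cross_kernel :: "real \<Rightarrow> real \<Rightarrow> real \<Rightarrow> real \<Rightarrow> real \<Rightarrow> real \<Rightarrow> real \<Rightarrow> real \<Rightarrow> real \<Rightarrow> real" where
  "cross_kernel y1 y2 y3 y4 y5 y6 x s r = (if 0 < x \<and> 0 < s \<and> s < r \<and> r < 1 then
     x powr (y1 + y2 - 1) * (1 - s + s * x) powr (- (y1 + y5)) * (1 - r + r * x) powr (- (y2 + y6)) *
     s powr (y1 + y4 - 1) * (r - s) powr (y2 + y5 - 1) * (1 - r) powr (y3 + y6 - 1) else 0)"

definition cross_integral :: "real \<Rightarrow> real \<Rightarrow> real \<Rightarrow> real \<Rightarrow> real \<Rightarrow> real \<Rightarrow> ennreal" where
  "cross_integral y1 y2 y3 y4 y5 y6 =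
     (\<integral>\<^sup>+x. \<integral>\<^sup>+s. \<integral>\<^sup>+r. ennreal (cross_kernel y1 y2 y3 y4 y5 y6 x s r) \<partial>lborel \<partial>lborel \<partial>lborel)"

lemma cross_kernel_measurable [measurable]:
  assumes "f \<in> borel_measurable M" "g \<in> borel_measurable M" "h \<in> borel_measurable M"
  shows "(\<lambda>w. cross_kernel y1 y2 y3 y4 y5 y6 (f w) (g w) (h w)) \<in> borel_measurable M"
  using assms unfolding cross_kernel_def by measurable

lemma nn_integral_scale:
  fixes f :: "real \<Rightarrow> real"
  assumes [measurable]: "f \<in> borel_measurable borel" and "c > 0" "\<And>x. f x \<ge> 0"
  shows "(\<integral>\<^sup>+x. ennreal (f x) \<partial>lborel) = (\<integral>\<^sup>+x. ennreal (c * f (c * x)) \<partial>lborel)"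
proof -
  have "(\<integral>\<^sup>+x. ennreal (f x) \<partial>lborel) = ennreal \<bar>c\<bar> * (\<integral>\<^sup>+x. ennreal (f (0 + c * x)) \<partial>lborel)"
    using assms(2) by (intro nn_integral_real_affine) auto
  also have "\<dots> = (\<integral>\<^sup>+x. ennreal c * ennreal (f (c * x)) \<partial>lborel)"
    using assms(2) by (subst nn_integral_cmult) auto
  also have "\<dots> = (\<integral>\<^sup>+x. ennreal (c * f (c * x)) \<partial>lborel)"
    using assms(2,3) by (intro nn_integral_cong) (auto simp: ennreal_mult)
  finally show ?thesis .
qed

text \<open>The new variable \<open>\<theta>\<close> is the cross ratio \<open>s (1 - r) / (r (1 - s))\<close>.\<close>

lemma cross_kernel_mobius:
  fixes \<theta> r x :: real
  assumes "0 < x" "0 < \<theta>" "\<theta> < 1" "0 < r" "r < 1"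
  defines "D \<equiv> 1 - (1 - \<theta>) * r"
  shows "(1 - r) / r * cross_kernel y1 y2 y3 y4 y5 y6 ((1 - r) / r * x) (\<theta> * r / D) r * (r * (1 - r) / D\<^sup>2) =
    \<theta> powr (y1 + y4 - 1) * (1 - \<theta>) powr (y2 + y5 - 1) *
    (x powr (y1 + y2 - 1) * (1 + x) powr (- (y2 + y6)) * (1 + \<theta> * x) powr (- (y1 + y5))) *
    (r powr (y4 + y5 - 1) * (1 - r) powr (y2 + y3 - 1) * D powr (- (y2 + y4)))"
proof -
  have D: "D > 0"
    using assms mult_strict_mono'[of "1 - \<theta>" 1 r 1] by (auto simp: D_def)
  have less: "\<theta> * r / D < r"
  proof -
    have "r - \<theta> * r / D = r * (1 - r) * (1 - \<theta>) / D"
      using D by (simp add: field_simps) (simp add: D_def algebra_simps)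
    also have "\<dots> > 0" using assms D by simp
    finally show ?thesis by simp
  qed
  \<comment> \<open>Scaling \<open>x\<close> by \<open>(1 - r) / r\<close> makes the two mixed bases
    of the kernel split. For fixed \<open>\<theta>\<close> the variables \<open>x\<close> and
    \<open>r\<close> are then separated, with only \<open>1 + \<theta> * x\<close> and
    \<open>D\<close> still involving \<open>\<theta>\<close> together with one of them.\<close>
  have e1: "1 - \<theta> * r / D + \<theta> * r / D * ((1 - r) / r * x) = (1 - r) * (1 + \<theta> * x) / D"
  proof -
    have "1 - \<theta> * r / D = (1 - r) / D"
      using D by (simp add: divide_simps) (simp add: D_def algebra_simps)
    moreover have "\<theta> * r / D * ((1 - r) / r * x) = (1 - r) * (\<theta> * x) / D"
      using assms(4) by simp
    ultimately show ?thesis by (simp add: add_divide_distrib ring_distribs)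
  qed
  have e2: "1 - r + r * ((1 - r) / r * x) = (1 - r) * (1 + x)"
    using assms by (simp add: field_simps)
  have e3: "r - \<theta> * r / D = r * (1 - r) * (1 - \<theta>) / D"
    using D by (simp add: field_simps) (simp add: D_def algebra_simps)
  \<comment> \<open>Both sides are monomials in positive quantities, so it suffices to compare
    logarithms, where the exponents add linearly. \<open>R\<close>, \<open>T\<close>,
    \<open>u\<close>, \<open>v\<close> stand for \<open>1 - r\<close>, \<open>1 - \<theta>\<close>,
    \<open>1 + x\<close>, \<open>1 + \<theta> * x\<close> and are generalised so that their
    logarithms stay atomic.\<close>
  have main: "R / r * ((R / r * x) powr (y1 + y2 - 1) * (R * v / D) powr (- (y1 + y5)) *
      (R * u) powr (- (y2 + y6)) * (\<theta> * r / D) powr (y1 + y4 - 1) *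
      (r * R * T / D) powr (y2 + y5 - 1) * R powr (y3 + y6 - 1)) * (r * R / D\<^sup>2) =
    \<theta> powr (y1 + y4 - 1) * T powr (y2 + y5 - 1) *
    (x powr (y1 + y2 - 1) * u powr (- (y2 + y6)) * v powr (- (y1 + y5))) *
    (r powr (y4 + y5 - 1) * R powr (y2 + y3 - 1) * D powr (- (y2 + y4)))" (is "?L = ?R")
    if pos: "R > 0" "T > 0" "u > 0" "v > 0" for R T u v
  proof -
    have "ln ?L = ln ?R"
      using pos D assms(1,2,4) by (simp add: ln_mult ln_div ln_powr ln_realpow algebra_simps)
    moreover have "?L > 0" "?R > 0" using pos D assms(1,2,4) by auto
    ultimately show ?thesis by (metis ln_inj_iff)
  qed
  have "cross_kernel y1 y2 y3 y4 y5 y6 ((1 - r) / r * x) (\<theta> * r / D) r =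
     ((1 - r) / r * x) powr (y1 + y2 - 1) * ((1 - r) * (1 + \<theta> * x) / D) powr (- (y1 + y5)) *
     ((1 - r) * (1 + x)) powr (- (y2 + y6)) *
     (\<theta> * r / D) powr (y1 + y4 - 1) * (r * (1 - r) * (1 - \<theta>) / D) powr (y2 + y5 - 1) *
     (1 - r) powr (y3 + y6 - 1)"
    unfolding cross_kernel_def e1 e2 e3 using less D assms(1-5) by simp
  moreover have "1 - r > 0" "1 - \<theta> > 0" "1 + x > 0" "1 + \<theta> * x > 0"
    using assms(1-5) by (auto intro: add_pos_pos)
  ultimately show ?thesis
    using main[of "1 - r" "1 - \<theta>" "1 + x" "1 + \<theta> * x"] by (simp only:)
qed

lemma cross_kernel_nonneg: "cross_kernel y1 y2 y3 y4 y5 y6 x s r \<ge> 0"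
  unfolding cross_kernel_def by auto

text \<open>The map \<open>\<theta> \<mapsto> \<theta> * r / (1 - (1 - \<theta>) * r)\<close> is
  increasing from \<open>[0, 1]\<close> onto \<open>[0, r]\<close> and has derivative
  \<open>r * (1 - r) / (1 - (1 - \<theta>) * r)^2\<close>. By \<open>supp\<close> the endpoints
  contribute nothing, so closed and open intervals can be exchanged.\<close>

lemma nn_integral_mobius:
  fixes f :: "real \<Rightarrow> real" and r :: real
  assumes [measurable]: "f \<in> borel_measurable borel" and r: "0 < r" "r < 1"
    and supp: "\<And>s. \<not> (0 < s \<and> s < r) \<Longrightarrow> f s = 0"
  shows "(\<integral>\<^sup>+s. ennreal (f s) \<partial>lborel) =
    (\<integral>\<^sup>+\<theta>. ennreal (if 0 < \<theta> \<and> \<theta> < 1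
        then f (\<theta> * r / (1 - (1 - \<theta>) * r)) * (r * (1 - r) / (1 - (1 - \<theta>) * r)\<^sup>2) else 0) \<partial>lborel)"
proof -
  let ?D = "\<lambda>\<theta>. 1 - (1 - \<theta>) * r" and ?g = "\<lambda>\<theta>. \<theta> * r / (1 - (1 - \<theta>) * r)"
  let ?g' = "\<lambda>\<theta>. r * (1 - r) / (1 - (1 - \<theta>) * r)\<^sup>2"
  have D: "?D \<theta> > 0" if "\<theta> \<in> {0..1}" for \<theta>
  proof -
    have "(1 - \<theta>) * r \<le> 1 * r" using that r by (intro mult_right_mono) auto
    then show ?thesis using r by linarith
  qed
  have "(\<integral>\<^sup>+s. ennreal (f s) \<partial>lborel) = (\<integral>\<^sup>+s. ennreal (f s * indicator {?g 0..?g 1} s) \<partial>lborel)"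
    by (intro nn_integral_cong) (auto simp: indicator_def supp)
  also have "\<dots> = (\<integral>\<^sup>+\<theta>. ennreal (f (?g \<theta>) * ?g' \<theta> * indicator {0..1} \<theta>) \<partial>lborel)"
  proof (rule nn_integral_substitution)
    show "set_borel_measurable borel {?g 0..?g 1} f"
      unfolding set_borel_measurable_def by measurable
    show "(?g has_real_derivative ?g' \<theta>) (at \<theta>)" if "\<theta> \<in> {0..1}" for \<theta>
      using D[OF that]
      by (auto intro!: derivative_eq_intros simp: power2_eq_square) (simp add: field_simps)
    show "continuous_on {0..1} ?g'"
      using D by (auto intro!: continuous_intros simp: less_le)
  qed (use r in auto)
  also have "\<dots> = (\<integral>\<^sup>+\<theta>. ennreal (if 0 < \<theta> \<and> \<theta> < 1 then f (?g \<theta>) * ?g' \<theta> else 0) \<partial>lborel)"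
    by (intro nn_integral_cong) (auto simp: indicator_def supp)
  finally show ?thesis .
qed

text \<open>Tonelli brings \<open>x\<close> innermost for the scaling by \<open>(1 - r) / r\<close>,
  then \<open>s\<close> innermost for the substitution by the cross ratio. Afterwards the integrand
  is a product \<open>?A \<theta> * (?B \<theta> x * ?C \<theta> r)\<close>, and the integrals over
  \<open>x\<close> and \<open>r\<close> are the two forms of Euler's integral.\<close>

lemma cross_integral_eq_euler_series:
  fixes y1 y2 y3 y4 y5 y6 :: real
  assumes y: "y1 > 0" "y2 > 0" "y3 > 0" "y4 > 0" "y5 > 0" "y6 > 0"
  shows "cross_integral y1 y2 y3 y4 y5 y6 =
    (\<integral>\<^sup>+\<theta>. ennreal (if 0 < \<theta> \<and> \<theta> < 1 then \<theta> powr (y1 + y4 - 1) * (1 - \<theta>) powr (y2 + y5 - 1) else 0) *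
       (euler_series (y1 + y5) (y1 + y2) (y5 + y6) (1 - \<theta>) *
        euler_series (y2 + y4) (y4 + y5) (y2 + y3) (1 - \<theta>)) \<partial>lborel)"
proof -
  let ?k = "cross_kernel y1 y2 y3 y4 y5 y6"
  \<comment> \<open>The kernel after the scaling of \<open>x\<close>, Jacobian included, cut off to
    \<open>0 < r < 1\<close>, where the scale factor is positive.\<close>
  let ?k2 = "\<lambda>r x s. if 0 < r \<and> r < 1 then (1 - r) / r * ?k ((1 - r) / r * x) s r else 0"
  let ?A = "\<lambda>\<theta>. ennreal (if 0 < \<theta> \<and> \<theta> < 1
      then \<theta> powr (y1 + y4 - 1) * (1 - \<theta>) powr (y2 + y5 - 1) else 0)"
  let ?B = "\<lambda>\<theta> x. ennreal (if 0 < x then x powr (y1 + y2 - 1) *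
      (1 + x) powr (- (y2 + y6)) * (1 + \<theta> * x) powr (- (y1 + y5)) else 0)"
  let ?C = "\<lambda>\<theta> r. ennreal (if 0 < r \<and> r < 1 then r powr (y4 + y5 - 1) *
      (1 - r) powr (y2 + y3 - 1) * (1 - (1 - \<theta>) * r) powr (- (y2 + y4)) else 0)"
  have "cross_integral y1 y2 y3 y4 y5 y6 =
      (\<integral>\<^sup>+s. \<integral>\<^sup>+x. \<integral>\<^sup>+r. ennreal (?k x s r) \<partial>lborel \<partial>lborel \<partial>lborel)"
    unfolding cross_integral_def by (rule nn_integral_swap12) measurable
  also have "\<dots> = (\<integral>\<^sup>+s. \<integral>\<^sup>+r. \<integral>\<^sup>+x. ennreal (?k x s r) \<partial>lborel \<partial>lborel \<partial>lborel)"
    by (rule nn_integral_swap23) measurable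
  also have "\<dots> = (\<integral>\<^sup>+r. \<integral>\<^sup>+s. \<integral>\<^sup>+x. ennreal (?k x s r) \<partial>lborel \<partial>lborel \<partial>lborel)"
    by (rule nn_integral_swap12) measurable
  also have "\<dots> = (\<integral>\<^sup>+r. \<integral>\<^sup>+s. \<integral>\<^sup>+x. ennreal (?k2 r x s) \<partial>lborel \<partial>lborel \<partial>lborel)"
  proof (rule nn_integral_cong, rule nn_integral_cong)
    fix r s :: real
    show "(\<integral>\<^sup>+x. ennreal (?k x s r) \<partial>lborel) = (\<integral>\<^sup>+x. ennreal (?k2 r x s) \<partial>lborel)"
    proof (cases "0 < s \<and> s < r \<and> r < 1")
      case True
      then have "(\<integral>\<^sup>+x. ennreal (?k x s r) \<partial>lborel) =
          (\<integral>\<^sup>+x. ennreal ((1 - r) / r * ?k ((1 - r) / r * x) s r) \<partial>lborel)"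
        by (intro nn_integral_scale) (auto simp: cross_kernel_nonneg)
      then show ?thesis using True by simp
    qed (auto intro!: nn_integral_cong simp: cross_kernel_def)
  qed
  also have "\<dots> = (\<integral>\<^sup>+r. \<integral>\<^sup>+x. \<integral>\<^sup>+s. ennreal (?k2 r x s) \<partial>lborel \<partial>lborel \<partial>lborel)"
    by (rule nn_integral_swap23) measurable
  also have "\<dots> = (\<integral>\<^sup>+r. \<integral>\<^sup>+x. \<integral>\<^sup>+\<theta>. ?A \<theta> * (?B \<theta> x * ?C \<theta> r) \<partial>lborel \<partial>lborel \<partial>lborel)"
  proof (rule nn_integral_cong, rule nn_integral_cong)
    fix r x :: real
    show "(\<integral>\<^sup>+s. ennreal (?k2 r x s) \<partial>lborel) = (\<integral>\<^sup>+\<theta>. ?A \<theta> * (?B \<theta> x * ?C \<theta> r) \<partial>lborel)"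
    proof (cases "0 < x \<and> 0 < r \<and> r < 1")
      case True
      then have "(\<integral>\<^sup>+s. ennreal (?k2 r x s) \<partial>lborel) =
        (\<integral>\<^sup>+\<theta>. ennreal (if 0 < \<theta> \<and> \<theta> < 1
        then ?k2 r x (\<theta> * r / (1 - (1 - \<theta>) * r)) * (r * (1 - r) / (1 - (1 - \<theta>) * r)\<^sup>2) else 0) \<partial>lborel)"
        by (intro nn_integral_mobius) (auto simp: cross_kernel_def)
      also have "\<dots> = (\<integral>\<^sup>+\<theta>. ?A \<theta> * (?B \<theta> x * ?C \<theta> r) \<partial>lborel)"
      proof (rule nn_integral_cong)
        fix \<theta> :: real
        show "ennreal (if 0 < \<theta> \<and> \<theta> < 1
          then ?k2 r x (\<theta> * r / (1 - (1 - \<theta>) * r)) * (r * (1 - r) / (1 - (1 - \<theta>) * r)\<^sup>2) else 0) =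
          ?A \<theta> * (?B \<theta> x * ?C \<theta> r)"
        proof (cases "0 < \<theta> \<and> \<theta> < 1")
          case th: True
          have "?k2 r x (\<theta> * r / (1 - (1 - \<theta>) * r)) * (r * (1 - r) / (1 - (1 - \<theta>) * r)\<^sup>2) =
             \<theta> powr (y1 + y4 - 1) * (1 - \<theta>) powr (y2 + y5 - 1) *
    ((x powr (y1 + y2 - 1) * (1 + x) powr (- (y2 + y6)) * (1 + \<theta> * x) powr (- (y1 + y5))) *
    (r powr (y4 + y5 - 1) * (1 - r) powr (y2 + y3 - 1) * (1 - (1 - \<theta>) * r) powr (- (y2 + y4))))"
            using True th cross_kernel_mobius[of x \<theta> r y1 y2 y3 y4 y5 y6]
            by (simp only: simp_thms if_True mult.assoc)
          then show ?thesis using True th by (simp add: ennreal_mult[symmetric] del: minus_add_distrib)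
        qed auto
      qed
      finally show ?thesis .
    next
      case False
      then have "?k2 r x s = 0" for s
        by (auto simp: cross_kernel_def zero_less_mult_iff zero_less_divide_iff)
      moreover have "?B \<theta> x * ?C \<theta> r = 0" for \<theta> using False by auto
      ultimately show ?thesis by (simp only: mult_zero_right ennreal_0)
    qed
  qed
  also have "\<dots> = (\<integral>\<^sup>+r. \<integral>\<^sup>+\<theta>. \<integral>\<^sup>+x. ?A \<theta> * (?B \<theta> x * ?C \<theta> r) \<partial>lborel \<partial>lborel \<partial>lborel)"
    by (rule nn_integral_swap23) measurable
  also have "\<dots> = (\<integral>\<^sup>+\<theta>. \<integral>\<^sup>+r. \<integral>\<^sup>+x. ?A \<theta> * (?B \<theta> x * ?C \<theta> r) \<partial>lborel \<partial>lborel \<partial>lborel)"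
    by (rule nn_integral_swap12) measurable
  also have "\<dots> = (\<integral>\<^sup>+\<theta>. ?A \<theta> * ((\<integral>\<^sup>+x. ?B \<theta> x \<partial>lborel) * (\<integral>\<^sup>+r. ?C \<theta> r \<partial>lborel)) \<partial>lborel)"
  proof (rule nn_integral_cong)
    fix \<theta> :: real
    have "(\<integral>\<^sup>+x. ?A \<theta> * (?B \<theta> x * ?C \<theta> r) \<partial>lborel) = ?A \<theta> * (\<integral>\<^sup>+x. ?B \<theta> x \<partial>lborel) * ?C \<theta> r" for r
      by (subst nn_integral_cmult, measurable, subst nn_integral_multc, measurable) (simp only: mult.assoc)
    then show "(\<integral>\<^sup>+r. \<integral>\<^sup>+x. ?A \<theta> * (?B \<theta> x * ?C \<theta> r) \<partial>lborel \<partial>lborel) =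
       ?A \<theta> * ((\<integral>\<^sup>+x. ?B \<theta> x \<partial>lborel) * (\<integral>\<^sup>+r. ?C \<theta> r \<partial>lborel))"
      by (simp only:) (subst nn_integral_cmult, measurable, simp only: mult.assoc)
  qed
  also have "\<dots> = (\<integral>\<^sup>+\<theta>. ?A \<theta> *
       (euler_series (y1 + y5) (y1 + y2) (y5 + y6) (1 - \<theta>) *
        euler_series (y2 + y4) (y4 + y5) (y2 + y3) (1 - \<theta>)) \<partial>lborel)"
  proof (rule nn_integral_cong)
    fix \<theta> :: real
    show "?A \<theta> * ((\<integral>\<^sup>+x. ?B \<theta> x \<partial>lborel) * (\<integral>\<^sup>+r. ?C \<theta> r \<partial>lborel)) =
       ?A \<theta> * (euler_series (y1 + y5) (y1 + y2) (y5 + y6) (1 - \<theta>) *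
        euler_series (y2 + y4) (y4 + y5) (y2 + y3) (1 - \<theta>))"
    proof (cases "0 < \<theta> \<and> \<theta> < 1")
      case True
      \<comment> \<open>With these parameters \<open>a - b - c\<close> is
        \<open>- (y2 + y6)\<close>, and \<open>z = 1 - \<theta>\<close> turns
        \<open>1 + (1 - z) * x\<close> into \<open>1 + \<theta> * x\<close>.\<close>
      have "(\<integral>\<^sup>+x. ?B \<theta> x \<partial>lborel) = euler_series (y1 + y5) (y1 + y2) (y5 + y6) (1 - \<theta>)"
        using nn_integral_euler_series_at_top[of "y1 + y5" "y1 + y2" "y5 + y6" "1 - \<theta>"] y True
        by (simp add: algebra_simps cong: if_cong)
      moreover have "(\<integral>\<^sup>+r. ?C \<theta> r \<partial>lborel) = euler_series (y2 + y4) (y4 + y5) (y2 + y3) (1 - \<theta>)"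
        using y True by (intro nn_integral_euler_series) auto
      ultimately show ?thesis by (simp only:)
    qed auto
  qed
  finally show ?thesis .
qed

text \<open>Interchanging the upper parameters in both Euler series yields exactly the series with
  \<open>y2\<close> and \<open>y5\<close> exchanged, and the weight \<open>?A\<close> depends only
  on \<open>y1 + y4\<close> and \<open>y2 + y5\<close>. The Gamma prefactors are those of
  \<open>euler_series_swap\<close>.\<close>

lemma cross_integral_swap:
  fixes y1 y2 y3 y4 y5 y6 :: real
  assumes y: "y1 > 0" "y2 > 0" "y3 > 0" "y4 > 0" "y5 > 0" "y6 > 0"
  shows "ennreal (Gamma (y1 + y5) * Gamma (y2 + y6) * (Gamma (y2 + y4) * Gamma (y3 + y5))) *
           cross_integral y1 y2 y3 y4 y5 y6 =
         ennreal (Gamma (y1 + y2) * Gamma (y5 + y6) * (Gamma (y4 + y5) * Gamma (y2 + y3))) *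
           cross_integral y1 y5 y3 y4 y2 y6"
proof -
  let ?A = "\<lambda>\<theta>. ennreal (if 0 < \<theta> \<and> \<theta> < 1
      then \<theta> powr (y1 + y4 - 1) * (1 - \<theta>) powr (y2 + y5 - 1) else 0)"
  have E[measurable]: "(\<lambda>\<theta>. euler_series a b c (1 - \<theta>)) \<in> borel_measurable lborel" for a b c
    unfolding euler_series_def by measurable
  have "?A \<theta> * ((ennreal (Gamma (y1 + y5) * Gamma (y2 + y6)) * euler_series (y1 + y5) (y1 + y2) (y5 + y6) (1 - \<theta>)) *
     (ennreal (Gamma (y2 + y4) * Gamma (y3 + y5)) * euler_series (y2 + y4) (y4 + y5) (y2 + y3) (1 - \<theta>))) =
    ?A \<theta> * ((ennreal (Gamma (y1 + y2) * Gamma (y5 + y6)) * euler_series (y1 + y2) (y1 + y5) (y2 + y6) (1 - \<theta>)) *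
     (ennreal (Gamma (y4 + y5) * Gamma (y2 + y3)) * euler_series (y4 + y5) (y2 + y4) (y3 + y5) (1 - \<theta>)))"
    for \<theta>
  proof (cases "0 < \<theta> \<and> \<theta> < 1")
    case True
    then show ?thesis
      using euler_series_swap[of "y1 + y5" "y1 + y2" "y5 + y6" "1 - \<theta>"] y
            euler_series_swap[of "y2 + y4" "y4 + y5" "y2 + y3" "1 - \<theta>"]
      by (simp add: add_ac)
  qed auto
  then have "(\<integral>\<^sup>+\<theta>. ennreal (Gamma (y1 + y5) * Gamma (y2 + y6) * (Gamma (y2 + y4) * Gamma (y3 + y5))) *
      (?A \<theta> * (euler_series (y1 + y5) (y1 + y2) (y5 + y6) (1 - \<theta>) *
         euler_series (y2 + y4) (y4 + y5) (y2 + y3) (1 - \<theta>))) \<partial>lborel) =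
     (\<integral>\<^sup>+\<theta>. ennreal (Gamma (y1 + y2) * Gamma (y5 + y6) * (Gamma (y4 + y5) * Gamma (y2 + y3))) *
      (?A \<theta> * (euler_series (y1 + y2) (y1 + y5) (y2 + y6) (1 - \<theta>) *
         euler_series (y4 + y5) (y2 + y4) (y3 + y5) (1 - \<theta>))) \<partial>lborel)"
    using y by (intro nn_integral_cong) (simp add: ennreal_mult Gamma_real_nonneg mult_ac)
  then show ?thesis
    unfolding cross_integral_eq_euler_series[OF y] cross_integral_eq_euler_series[OF y(1,5,3,4,2,6)]
    by (subst (asm) (1 2) nn_integral_cmult) (auto simp: add_ac cong: if_cong)
qed

subsection \<open>Reduction of the two series to the triple integral\<close>

text \<open>Stated for a slope \<open>c\<close> of either sign: with \<open>t = 1\<close> and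
  \<open>c = x - 1\<close> it serves for \<open>x < 1\<close>, where the order of the variables is
  reversed, as well as for \<open>x > 1\<close>. The Jacobian is
  \<open>\<bar>c\<bar> * \<bar>c\<bar>\<close>.\<close>

lemma nn_integral_affine2:
  fixes f :: "real \<Rightarrow> real \<Rightarrow> real"
  assumes f: "(\<lambda>(p, q). f p q) \<in> borel_measurable (lborel \<Otimes>\<^sub>M lborel)"
    and c: "c \<noteq> 0" and nonneg: "\<And>p q. f p q \<ge> 0"
  shows "(\<integral>\<^sup>+p. \<integral>\<^sup>+q. ennreal (f p q) \<partial>lborel \<partial>lborel) =
         (\<integral>\<^sup>+s. \<integral>\<^sup>+r. ennreal (c\<^sup>2 * f (t + c * s) (t + c * r)) \<partial>lborel \<partial>lborel)"
proof -
  have [measurable]: "(\<lambda>w. f (g w) (h w)) \<in> borel_measurable M"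
    if [measurable]: "g \<in> borel_measurable M" "h \<in> borel_measurable M" for g h and M :: "'a measure"
  proof -
    have "(\<lambda>w. (g w, h w)) \<in> M \<rightarrow>\<^sub>M lborel \<Otimes>\<^sub>M lborel" by measurable
    from measurable_compose[OF this f] show ?thesis by simp
  qed
  have [measurable]: "(\<lambda>(p, q). f p q) \<in> borel_measurable (borel \<Otimes>\<^sub>M borel)"
    using f by simp
  have q: "(\<integral>\<^sup>+q. ennreal (f p q) \<partial>lborel) = ennreal \<bar>c\<bar> * (\<integral>\<^sup>+r. ennreal (f p (t + c * r)) \<partial>lborel)" for p
    using c by (intro nn_integral_real_affine) auto
  have "(\<integral>\<^sup>+p. \<integral>\<^sup>+q. ennreal (f p q) \<partial>lborel \<partial>lborel) =
      ennreal \<bar>c\<bar> * (\<integral>\<^sup>+s. \<integral>\<^sup>+q. ennreal (f (t + c * s) q) \<partial>lborel \<partial>lborel)"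
    using c by (intro nn_integral_real_affine) measurable
  also have "\<dots> = (\<integral>\<^sup>+s. \<integral>\<^sup>+r. ennreal (c\<^sup>2) * ennreal (f (t + c * s) (t + c * r)) \<partial>lborel \<partial>lborel)"
    unfolding q
    by (subst (1 2) nn_integral_cmult[symmetric], measurable)
       (intro nn_integral_cong, simp add: nn_integral_cmult mult.assoc[symmetric] ennreal_mult[symmetric] power2_eq_square)
  also have "\<dots> = (\<integral>\<^sup>+s. \<integral>\<^sup>+r. ennreal (c\<^sup>2 * f (t + c * s) (t + c * r)) \<partial>lborel \<partial>lborel)"
    using nonneg by (simp add: ennreal_mult)
  finally show ?thesis .
qed

text \<open>The differences \<open>q - x\<close>, \<open>p - q\<close>, \<open>1 - p\<close> are
  \<open>1 - x\<close> times \<open>1 - r\<close>, \<open>r - s\<close>, \<open>s\<close>. The total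
  exponent of \<open>1 - x\<close> on the right is
  \<open>2 + (y3 + y6 - 1) + (y2 + y5 - 1) + (y1 + y4 - 1) - a\<close>, which vanishes by the choice
  of \<open>a\<close>.\<close>

lemma cross_kernel_lower:
  fixes y1 y2 y3 y4 y5 y6 x s r :: real
  assumes "0 < x" "x < 1"
  defines "a \<equiv> y1 + y2 + y3 + y4 + y5 + y6 - 1" and "p \<equiv> 1 + (x - 1) * s" and "q \<equiv> 1 + (x - 1) * r"
  shows "cross_kernel y1 y2 y3 y4 y5 y6 x s r = (x - 1)\<^sup>2 *
    (if 0 < x \<and> x < q \<and> q < p \<and> p < 1 then
      x powr (y1 + y2 - 1) * (q - x) powr (y3 + y6 - 1) * (q powr (- (y2 + y6)) * (p - q) powr (y2 + y5 - 1)) *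
      (p powr (- (y1 + y5)) * (1 - p) powr (y1 + y4 - 1)) * (1 - x) powr (- a) else 0)"
proof -
  define z where "z = 1 - x"
  have z: "z > 0" using assms by (simp add: z_def)
  have e: "q - x = z * (1 - r)" "p - q = z * (r - s)" "1 - p = z * s"
    by (simp_all add: p_def q_def z_def algebra_simps)
  have c: "x < q \<longleftrightarrow> r < 1" "q < p \<longleftrightarrow> s < r" "p < 1 \<longleftrightarrow> 0 < s"
    using e z by (metis diff_gt_0_iff_gt zero_less_mult_pos mult_pos_pos)+
  show ?thesis
  proof (cases "0 < s \<and> s < r \<and> r < 1")
    case True
    then have pq: "x < q" "q < p" "p < 1" using c by auto
    have k: "1 - s + s * x = p" "1 - r + r * x = q"
      by (simp_all add: p_def q_def algebra_simps)
    have gen: "x powr (y1 + y2 - 1) * p powr (- (y1 + y5)) * q powr (- (y2 + y6)) *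
     s powr (y1 + y4 - 1) * V powr (y2 + y5 - 1) * U powr (y3 + y6 - 1) =
     z\<^sup>2 * (x powr (y1 + y2 - 1) * (z * U) powr (y3 + y6 - 1) * (q powr (- (y2 + y6)) * (z * V) powr (y2 + y5 - 1)) *
      (p powr (- (y1 + y5)) * (z * s) powr (y1 + y4 - 1)) * z powr (- a))" (is "?L = ?R") if UV: "U > 0" "V > 0" for U V
    proof -
      have pos: "p > 0" "q > 0" "s > 0"
        using pq assms(1,2) True by linarith+
      have "ln ?L = ln ?R"
        using pos UV z assms(1) by (simp add: ln_mult ln_powr ln_realpow algebra_simps) (simp add: a_def algebra_simps)
      moreover have "?L > 0" "?R > 0" using pos UV z assms(1) by auto
      ultimately show ?thesis by (metis ln_inj_iff)
    qed
    note gen[of "1 - r" "r - s"]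
    moreover have "(x - 1)\<^sup>2 = z\<^sup>2" by (simp add: z_def power2_commute)
    ultimately show ?thesis
      unfolding cross_kernel_def k e c using True assms(1) by (simp add: z_def)
  qed (auto simp: cross_kernel_def c)
qed

text \<open>The same cancellation with \<open>x - 1\<close> in place of \<open>1 - x\<close>; the
  positive slope now gives the order \<open>1 < p < q < x\<close>.\<close>

lemma cross_kernel_upper:
  fixes y1 y2 y3 y4 y5 y6 x s r :: real
  assumes "1 < x"
  defines "a \<equiv> y1 + y2 + y3 + y4 + y5 + y6 - 1" and "p \<equiv> 1 + (x - 1) * s" and "q \<equiv> 1 + (x - 1) * r"
  shows "cross_kernel y1 y2 y3 y4 y5 y6 x s r = (x - 1)\<^sup>2 *
    (if 1 < p \<and> p < q \<and> q < x then
      x powr (y1 + y2 - 1) * (x - q) powr (y3 + y6 - 1) * (q powr (- (y2 + y6)) * (q - p) powr (y2 + y5 - 1)) *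
      (p powr (- (y1 + y5)) * (p - 1) powr (y1 + y4 - 1)) * (x - 1) powr (- a) else 0)"
proof -
  define z where "z = x - 1"
  have z: "z > 0" using assms by (simp add: z_def)
  have e: "x - q = z * (1 - r)" "q - p = z * (r - s)" "p - 1 = z * s"
    by (simp_all add: p_def q_def z_def algebra_simps)
  have c: "q < x \<longleftrightarrow> r < 1" "p < q \<longleftrightarrow> s < r" "1 < p \<longleftrightarrow> 0 < s"
    using e z by (metis diff_gt_0_iff_gt zero_less_mult_pos mult_pos_pos)+
  show ?thesis
  proof (cases "0 < s \<and> s < r \<and> r < 1")
    case True
    then have pq: "q < x" "p < q" "1 < p" using c by auto
    have k: "1 - s + s * x = p" "1 - r + r * x = q"
      by (simp_all add: p_def q_def algebra_simps)
    have gen: "x powr (y1 + y2 - 1) * p powr (- (y1 + y5)) * q powr (- (y2 + y6)) *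
     s powr (y1 + y4 - 1) * V powr (y2 + y5 - 1) * U powr (y3 + y6 - 1) =
     z\<^sup>2 * (x powr (y1 + y2 - 1) * (z * U) powr (y3 + y6 - 1) * (q powr (- (y2 + y6)) * (z * V) powr (y2 + y5 - 1)) *
      (p powr (- (y1 + y5)) * (z * s) powr (y1 + y4 - 1)) * z powr (- a))" (is "?L = ?R") if UV: "U > 0" "V > 0" for U V
    proof -
      have pos: "p > 0" "q > 0" "s > 0" "x > 0"
        using pq assms(1) True by linarith+
      have "ln ?L = ln ?R"
        using pos UV z assms(1) by (simp add: ln_mult ln_powr ln_realpow algebra_simps) (simp add: a_def algebra_simps)
      moreover have "?L > 0" "?R > 0" using pos UV z assms(1) by auto
      ultimately show ?thesis by (metis ln_inj_iff)
    qed
    from gen[of "1 - r" "r - s"] show ?thesis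
      unfolding cross_kernel_def k e c using True assms(1) by (simp add: z_def)
  qed (auto simp: cross_kernel_def c)
qed

text \<open>Undoing the rescaling separates the regions \<open>x < 1\<close> and
  \<open>x > 1\<close>. Expanding \<open>(1 - x) powr (- a)\<close> in powers of \<open>x\<close>,
  respectively \<open>(x - 1) powr (- a)\<close> in powers of \<open>1 / x\<close>, makes every term
  a Beta chain.\<close>

lemma cross_integral_eq_sums:
  fixes y1 y2 y3 y4 y5 y6 :: real
  assumes y: "y1 > 0" "y2 > 0" "y3 > 0" "y4 > 0" "y5 > 0" "y6 > 0"
  defines "a \<equiv> y1 + y2 + y3 + y4 + y5 + y6 - 1"
  assumes a: "a > 0"
  shows "cross_integral y1 y2 y3 y4 y5 y6 =
    (\<Sum>k. ennreal (pochhammer a k / fact k) * ennreal (Beta (y1 + y2 + real k) (y3 + y6) *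
        Beta (y1 + y3 + real k) (y2 + y5) * Beta (y2 + y3 + real k) (y1 + y4))) +
    (\<Sum>k. ennreal (pochhammer a k / fact k) * ennreal (Beta (y4 + y5 + real k) (y3 + y6) *
        Beta (y4 + y6 + real k) (y2 + y5) * Beta (y5 + y6 + real k) (y1 + y4)))"
proof -
  let ?k = "cross_kernel y1 y2 y3 y4 y5 y6"
  define e1 where "e1 = (\<lambda>p q x. if 0 < x \<and> x < q \<and> q < p \<and> p < 1 then
      x powr (y1 + y2 - 1) * (q - x) powr (y3 + y6 - 1) * (q powr (- (y2 + y6)) * (p - q) powr (y2 + y5 - 1)) *
      (p powr (- (y1 + y5)) * (1 - p) powr (y1 + y4 - 1)) * (1 - x) powr (- a) else 0)"
  define e2 where "e2 = (\<lambda>p q x. if 1 < p \<and> p < q \<and> q < x then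
      x powr (y1 + y2 - 1) * (x - q) powr (y3 + y6 - 1) * (q powr (- (y2 + y6)) * (q - p) powr (y2 + y5 - 1)) *
      (p powr (- (y1 + y5)) * (p - 1) powr (y1 + y4 - 1)) * (x - 1) powr (- a) else 0)"
  have nonneg: "e1 p q x \<ge> 0" "e2 p q x \<ge> 0" for p q x
    by (auto simp: e1_def e2_def)
  have [measurable]: "(\<lambda>w. e1 (f w) (g w) (h w)) \<in> borel_measurable M"
      "(\<lambda>w. e2 (f w) (g w) (h w)) \<in> borel_measurable M"
    if [measurable]: "f \<in> borel_measurable M" "g \<in> borel_measurable M" "h \<in> borel_measurable M"
    for f g h and M :: "'a measure"
    unfolding e1_def e2_def by measurable
  have c: "pochhammer a k / fact k \<ge> 0" for k
    using a by (intro divide_nonneg_pos pochhammer_nonneg) auto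
  have inner: "(\<integral>\<^sup>+s. \<integral>\<^sup>+r. ennreal (?k x s r) \<partial>lborel \<partial>lborel) =
      (\<integral>\<^sup>+p. \<integral>\<^sup>+q. ennreal (e1 p q x) \<partial>lborel \<partial>lborel) + (\<integral>\<^sup>+p. \<integral>\<^sup>+q. ennreal (e2 p q x) \<partial>lborel \<partial>lborel)"
    if x1: "x \<noteq> 1" for x :: real
  proof -
    consider "x \<le> 0" | "0 < x" "x < 1" | "1 < x" using x1 by linarith
    then show ?thesis
    proof cases
      case 1
      then have "?k x s r = 0" "e1 s r x = 0" "e2 s r x = 0" for s r
        by (auto simp: cross_kernel_def e1_def e2_def)
      then show ?thesis by simp
    next
      case 2
      then have "e2 p q x = 0" for p q by (auto simp: e2_def)
      moreover have "?k x s r = (x - 1)\<^sup>2 * e1 (1 + (x - 1) * s) (1 + (x - 1) * r) x" for s r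
        using cross_kernel_lower[OF 2, of y1 y2 y3 y4 y5 y6 s r] unfolding e1_def a_def .
      ultimately show ?thesis
        using 2 by (subst nn_integral_affine2[where c = "x - 1" and t = 1 and f = "\<lambda>p q. e1 p q x"])
          (auto simp: nonneg)
    next
      case 3
      then have "e1 p q x = 0" for p q by (auto simp: e1_def)
      moreover have "?k x s r = (x - 1)\<^sup>2 * e2 (1 + (x - 1) * s) (1 + (x - 1) * r) x" for s r
        using cross_kernel_upper[OF 3, of y1 y2 y3 y4 y5 y6 s r] unfolding e2_def a_def .
      ultimately show ?thesis
        using 3 by (subst nn_integral_affine2[where c = "x - 1" and t = 1 and f = "\<lambda>p q. e2 p q x"])
          (auto simp: nonneg)
    qed
  qed
  \<comment> \<open>The exponents are written in the shape of the Beta chain. The shift by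
    \<open>k\<close> enters all three \<open>b\<close>-parameters, so it cancels in the powers of
    \<open>q\<close> and \<open>p\<close> and survives only in the power of
    \<open>x\<close>.\<close>
  have sum1: "ennreal (e1 p q x) = (\<Sum>k. ennreal (pochhammer a k / fact k) *
      ennreal (if 0 < x \<and> x < q \<and> q < p \<and> p < 1 then
        x powr ((y1 + y2 + real k) - 1) * (q - x) powr (y3 + y6 - 1) *
        (q powr ((y1 + y3 + real k) - (y1 + y2 + real k) - (y3 + y6)) * (p - q) powr (y2 + y5 - 1)) *
        (p powr ((y2 + y3 + real k) - (y1 + y3 + real k) - (y2 + y5)) * (1 - p) powr (y1 + y4 - 1)) else 0))"
    (is "_ = (\<Sum>k. ?c k * ennreal (?e k))") for p q x
  proof (cases "0 < x \<and> x < q \<and> q < p \<and> p < 1")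
    case True
    let ?C = "x powr (y1 + y2 - 1) * (q - x) powr (y3 + y6 - 1) * (q powr (- (y2 + y6)) * (p - q) powr (y2 + y5 - 1)) *
      (p powr (- (y1 + y5)) * (1 - p) powr (y1 + y4 - 1))"
    have "ennreal (e1 p q x) = ennreal ?C * ennreal ((1 - x) powr (- a))"
      using True by (simp add: e1_def ennreal_mult[symmetric] mult_ac)
    also have "\<dots> = (\<Sum>k. ennreal ?C * ennreal (pochhammer a k / fact k * x ^ k))"
      using True a by (subst binomial_series_ennreal) auto
    also have "\<dots> = (\<Sum>k. ?c k * ennreal (?e k))"
    proof (intro arg_cong[of _ _ suminf] ext)
      fix k
      have x: "x powr ((y1 + y2 + real k) - 1) = x powr (y1 + y2 - 1) * x ^ k"
        using True by (simp add: powr_realpow[symmetric] powr_add[symmetric] algebra_simps)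
      have qp: "(y1 + y3 + real k) - (y1 + y2 + real k) - (y3 + y6) = - (y2 + y6)"
         "(y2 + y3 + real k) - (y1 + y3 + real k) - (y2 + y5) = - (y1 + y5)" by simp_all
      have "ennreal ?C * ennreal (P * x ^ k) = ennreal P * ennreal (?e k)" if "P \<ge> 0" for P
        unfolding x qp using True that by (simp add: ennreal_mult[symmetric] mult_ac del: minus_add_distrib)
      from this[OF c] show "ennreal ?C * ennreal (pochhammer a k / fact k * x ^ k) = ?c k * ennreal (?e k)" .
    qed
    finally show ?thesis .
  qed (auto simp: e1_def)
  have sum2: "ennreal (e2 p q x) = (\<Sum>k. ennreal (pochhammer a k / fact k) *
      ennreal (if 1 < p \<and> p < q \<and> q < x then
        x powr (- ((y4 + y5 + real k) + (y3 + y6))) * (x - q) powr (y3 + y6 - 1) *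
        (q powr ((y4 + y5 + real k) - (y4 + y6 + real k) - (y2 + y5)) * (q - p) powr (y2 + y5 - 1)) *
        (p powr ((y4 + y6 + real k) - (y5 + y6 + real k) - (y1 + y4)) * (p - 1) powr (y1 + y4 - 1)) else 0))"
    (is "_ = (\<Sum>k. ?c k * ennreal (?e k))") for p q x
  proof (cases "1 < p \<and> p < q \<and> q < x")
    case True
    let ?C = "(x - q) powr (y3 + y6 - 1) * (q powr (- (y2 + y6)) * (q - p) powr (y2 + y5 - 1)) *
      (p powr (- (y1 + y5)) * (p - 1) powr (y1 + y4 - 1))"
    let ?D = "?C * x powr (- (y3 + y4 + y5 + y6))"
    \<comment> \<open>Here \<open>x > 1\<close>, so the binomial series is taken at
      \<open>1 / x\<close>. The extracted \<open>x powr (- a)\<close> combines with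
      \<open>x powr (y1 + y2 - 1)\<close> to the exponent
      \<open>- (y3 + y4 + y5 + y6)\<close>.\<close>
    have "x - 1 = x * (1 - 1 / x)" using True by (simp add: field_simps)
    then have "(x - 1) powr (- a) = x powr (- a) * (1 - 1 / x) powr (- a)"
      using True by (simp only: powr_mult)
    moreover have "x powr (- (y3 + y4 + y5 + y6)) = x powr (y1 + y2 - 1) * x powr (- a)"
      by (subst powr_add[symmetric], rule arg_cong[where f = "\<lambda>e. x powr e"]) (simp add: a_def)
    ultimately have "e2 p q x = ?D * (1 - 1 / x) powr (- a)"
      using True by (simp only: e2_def if_True mult_ac simp_thms)
    then have "ennreal (e2 p q x) = ennreal ?D * ennreal ((1 - 1 / x) powr (- a))"
      by (simp only: ennreal_mult[symmetric] zero_le_mult_iff powr_ge_zero simp_thms)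
    also have "\<dots> = (\<Sum>k. ennreal ?D * ennreal (pochhammer a k / fact k * (1 / x) ^ k))"
      using True a by (subst binomial_series_ennreal) auto
    also have "\<dots> = (\<Sum>k. ?c k * ennreal (?e k))"
    proof (intro arg_cong[of _ _ suminf] ext)
      fix k
      have x: "x powr (- ((y4 + y5 + real k) + (y3 + y6))) = x powr (- (y3 + y4 + y5 + y6)) * (1 / x) ^ k"
        using True by (simp add: powr_realpow powr_add powr_diff powr_minus field_simps)
      have qp: "(y4 + y5 + real k) - (y4 + y6 + real k) - (y2 + y5) = - (y2 + y6)"
         "(y4 + y6 + real k) - (y5 + y6 + real k) - (y1 + y4) = - (y1 + y5)" by simp_all
      have "ennreal (C * X) * ennreal (P * (1 / x) ^ k) = ennreal P * ennreal (X * (1 / x) ^ k * C)"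
        if "P \<ge> 0" "C \<ge> 0" "X \<ge> 0" for P C X
        using True that by (simp add: ennreal_mult[symmetric] mult_ac)
      from this[OF c, of ?C "x powr (- (y3 + y4 + y5 + y6))" k]
      show "ennreal ?D * ennreal (pochhammer a k / fact k * (1 / x) ^ k) = ?c k * ennreal (?e k)"
        unfolding x qp using True by (simp add: mult.assoc del: minus_add_distrib)
    qed
    finally show ?thesis .
  qed (auto simp: e2_def)
  have "cross_integral y1 y2 y3 y4 y5 y6 =
      (\<integral>\<^sup>+x. (\<integral>\<^sup>+p. \<integral>\<^sup>+q. ennreal (e1 p q x) \<partial>lborel \<partial>lborel) +
             (\<integral>\<^sup>+p. \<integral>\<^sup>+q. ennreal (e2 p q x) \<partial>lborel \<partial>lborel) \<partial>lborel)"
    \<comment> \<open>At \<open>x = 1\<close> the slope \<open>x - 1\<close> degenerates, so the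
      pointwise identity holds only off this null set.\<close>
    unfolding cross_integral_def using AE_lborel_singleton[of "1::real"] inner
    by (intro nn_integral_cong_AE) auto
  also have "\<dots> = (\<integral>\<^sup>+x. \<integral>\<^sup>+p. \<integral>\<^sup>+q. ennreal (e1 p q x) \<partial>lborel \<partial>lborel \<partial>lborel) +
      (\<integral>\<^sup>+x. \<integral>\<^sup>+p. \<integral>\<^sup>+q. ennreal (e2 p q x) \<partial>lborel \<partial>lborel \<partial>lborel)"
    by (intro nn_integral_add) measurable
  also have "(\<integral>\<^sup>+x. \<integral>\<^sup>+p. \<integral>\<^sup>+q. ennreal (e1 p q x) \<partial>lborel \<partial>lborel \<partial>lborel) =
      (\<integral>\<^sup>+p. \<integral>\<^sup>+x. \<integral>\<^sup>+q. ennreal (e1 p q x) \<partial>lborel \<partial>lborel \<partial>lborel)"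
    by (rule nn_integral_swap12) measurable
  also have "\<dots> = (\<integral>\<^sup>+p. \<integral>\<^sup>+q. \<integral>\<^sup>+x. ennreal (e1 p q x) \<partial>lborel \<partial>lborel \<partial>lborel)"
    by (rule nn_integral_swap23) measurable
  also have "\<dots> = (\<Sum>k. ennreal (pochhammer a k / fact k) * ennreal (Beta (y1 + y2 + real k) (y3 + y6) *
        Beta (y1 + y3 + real k) (y2 + y5) * Beta (y2 + y3 + real k) (y1 + y4)))"
    unfolding sum1 using y by (subst nn_integral_suminf_cmult3, measurable, subst nn_integral_Beta_chain) auto
  also have "(\<integral>\<^sup>+x. \<integral>\<^sup>+p. \<integral>\<^sup>+q. ennreal (e2 p q x) \<partial>lborel \<partial>lborel \<partial>lborel) =
      (\<integral>\<^sup>+p. \<integral>\<^sup>+x. \<integral>\<^sup>+q. ennreal (e2 p q x) \<partial>lborel \<partial>lborel \<partial>lborel)"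
    by (rule nn_integral_swap12) measurable
  also have "\<dots> = (\<integral>\<^sup>+p. \<integral>\<^sup>+q. \<integral>\<^sup>+x. ennreal (e2 p q x) \<partial>lborel \<partial>lborel \<partial>lborel)"
    by (rule nn_integral_swap23) measurable
  also have "\<dots> = (\<Sum>k. ennreal (pochhammer a k / fact k) * ennreal (Beta (y4 + y5 + real k) (y3 + y6) *
        Beta (y4 + y6 + real k) (y2 + y5) * Beta (y5 + y6 + real k) (y1 + y4)))"
    unfolding sum2 using y by (subst nn_integral_suminf_cmult3, measurable, subst nn_integral_Beta_chain_at_top) auto
  finally show ?thesis .
qed

subsection \<open>Convergence and holomorphy of the series\<close>

text \<open>The square of the left side is \<open>1 + (2 * Re w + (norm w)^2)\<close>, to which
  \<open>1 + t \<le> exp t\<close> applies. The linear term \<open>Re w\<close> must be exact,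
  because the Saalschuetz condition acts on the sum of these terms.\<close>

lemma norm_one_plus_le_exp: "norm (1 + w :: complex) \<le> exp (Re w + (norm w)\<^sup>2 / 2)"
proof -
  have "(norm (1 + w))\<^sup>2 = 1 + (2 * Re w + (norm w)\<^sup>2)"
    unfolding cmod_power2 by (simp add: power2_eq_square algebra_simps)
  also have "\<dots> \<le> exp (2 * Re w + (norm w)\<^sup>2)" by (rule exp_ge_add_one_self)
  also have "\<dots> = (exp (Re w + (norm w)\<^sup>2 / 2))\<^sup>2"
    by (simp add: exp_double[symmetric] algebra_simps)
  finally show ?thesis by (rule power2_le_imp_le) simp
qed

text \<open>Uses \<open>(1 + w) (1 - w) = 1 - w\<^sup>2\<close> and the previous upper bound for \<open>1 - w\<close>.\<close>

lemma inverse_norm_one_plus_le_exp: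
  fixes w :: complex
  assumes "norm w \<le> 1 / 2"
  shows "1 / norm (1 + w) \<le> exp (- Re w + 2 * (norm w)\<^sup>2)"
proof -
  define x where "x = (norm w)\<^sup>2"
  have x: "0 \<le> x" "x \<le> 1 / 4"
    using assms power_mono[of "norm w" "1/2" 2] by (auto simp: x_def power2_eq_square)
  have "w \<noteq> -1" using assms by auto
  then have nz: "norm (1 + w) > 0" by (metis add_eq_0_iff zero_less_norm_iff)
  have "1 - x \<le> norm (1 - w\<^sup>2)"
    using norm_triangle_ineq2[of 1 "w\<^sup>2"] by (simp add: norm_power x_def)
  also have "\<dots> = norm (1 + w) * norm (1 - w)"
    by (simp add: norm_mult[symmetric] power2_eq_square algebra_simps)
  finally have 1: "1 - x \<le> norm (1 + w) * norm (1 - w)" .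
  have 2: "norm (1 - w) \<le> exp (- Re w + x / 2)"
    using norm_one_plus_le_exp[of "- w"] by (simp add: x_def)
  \<comment> \<open>The quadratic term \<open>2 * x^2\<close> is at most \<open>x / 2\<close> since
    \<open>x \<le> 1 / 4\<close>. The resulting \<open>3 / 2 * x\<close> and the
    \<open>x / 2\<close> from fact \<open>2\<close> add up to the constant \<open>2\<close> of the
    claim.\<close>
  have "- (3 / 2 * x) \<le> - x - 2 * x\<^sup>2"
    using x mult_left_mono[of x "1/4" x] by (simp add: power2_eq_square)
  also have "\<dots> \<le> ln (1 - x)" using x by (intro ln_one_minus_pos_lower_bound) auto
  finally have 3: "exp (- (3 / 2 * x)) \<le> 1 - x" using x by (simp add: ln_ge_iff)
  have "exp (- (3 / 2 * x)) \<le> norm (1 + w) * exp (- Re w + x / 2)"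
    using 1 2 3 nz by (meson mult_left_mono norm_ge_zero order_trans)
  then have "exp (- (3 / 2 * x)) * exp (3 / 2 * x) \<le> norm (1 + w) * exp (- Re w + x / 2) * exp (3 / 2 * x)"
    by (intro mult_right_mono) auto
  then have "1 \<le> norm (1 + w) * exp (- Re w + 2 * x)"
    by (simp add: exp_add[symmetric] mult.assoc)
  then show ?thesis using nz by (simp add: divide_le_eq mult.commute x_def)
qed

section \<open>Decay of the terms of the regularised series\<close>

definition reg_term :: "nat \<Rightarrow> complex \<Rightarrow> complex \<Rightarrow> complex \<Rightarrow> complex \<Rightarrow> complex \<Rightarrow> complex \<Rightarrow> complex \<Rightarrow> complex" where
  "reg_term k a b c d e f g = (pochhammer a k * pochhammer b k * pochhammer c k * pochhammer d k) / fact k *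
          (rGamma (of_nat k + e) * rGamma (of_nat k + f) * rGamma (of_nat k + g))"

text \<open>By the Saalschuetz condition the ratio of consecutive terms is \<open>1 - 2/j + O(1/j\<^sup>2)\<close>; any exponent
  between 1 and 2 would do in place of \<open>3/2\<close>.\<close>

lemma reg_term_ratio:
  fixes a b c d e f g :: complex and R :: real
  assumes sum: "e + f + g - a - b - c - d = 1"
    and R: "R \<ge> 1" "norm a \<le> R" "norm b \<le> R" "norm c \<le> R" "norm d \<le> R" "norm e \<le> R" "norm f \<le> R" "norm g \<le> R"
    and j: "real j \<ge> 16 * R\<^sup>2"
  shows "norm (reg_term (Suc j) a b c d e f g) \<le>
         norm (reg_term j a b c d e f g) * (real j / real (Suc j)) powr (3 / 2)"
proof -
  define J where "J = real j"
  have R2: "R \<le> R\<^sup>2" using R(1) by (simp add: power2_eq_square)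
  \<comment> \<open>\<open>J \<ge> 2 * R\<close> gives \<open>norm (u / J) \<le> 1 / 2\<close> for
    the inverse bound, \<open>J > R\<close> keeps the denominators nonzero, and
    \<open>J \<ge> 16 * R^2\<close> lets \<open>8 * R^2 / J^2\<close> be absorbed by half of
    \<open>1 / J\<close>.\<close>
  have J: "J \<ge> 16 * R\<^sup>2" "J > 0" "J \<ge> 2 * R" "J > R" using j R(1) R2 by (auto simp: J_def)
  have up: "norm (u + of_nat j) \<le> J * exp (Re u / J + R\<^sup>2 / 2 / J\<^sup>2)" if "norm u \<le> R" for u
  proof -
    have "u + of_nat j = of_real J * (1 + u / of_real J)"
      using J by (simp add: J_def field_simps)
    then have "norm (u + of_nat j) = J * norm (1 + u / of_real J)"
      using J by (simp add: norm_mult)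
    also have "\<dots> \<le> J * exp (Re (u / of_real J) + (norm (u / of_real J))\<^sup>2 / 2)"
      using J by (intro mult_left_mono norm_one_plus_le_exp) auto
    also have "\<dots> \<le> J * exp (Re u / J + R\<^sup>2 / 2 / J\<^sup>2)"
    proof -
      have "(norm u)\<^sup>2 / (2 * J\<^sup>2) \<le> R\<^sup>2 / (2 * J\<^sup>2)"
        using that by (intro divide_right_mono power_mono) auto
      then show ?thesis using J by (simp add: norm_divide power_divide mult.commute)
    qed
    finally show ?thesis .
  qed
  have lo: "1 / norm (u + of_nat j) \<le> 1 / J * exp (- (Re u / J) + 2 * R\<^sup>2 / J\<^sup>2)" if "norm u \<le> R" for u
  proof -
    have "u + of_nat j = of_real J * (1 + u / of_real J)"
      using J by (simp add: J_def field_simps)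
    then have "1 / norm (u + of_nat j) = 1 / J * (1 / norm (1 + u / of_real J))"
      using J by (simp add: norm_mult)
    also have "\<dots> \<le> 1 / J * exp (- Re (u / of_real J) + 2 * (norm (u / of_real J))\<^sup>2)"
      using J that by (intro mult_left_mono inverse_norm_one_plus_le_exp) (auto simp: norm_divide field_simps)
    also have "\<dots> \<le> 1 / J * exp (- (Re u / J) + 2 * R\<^sup>2 / J\<^sup>2)"
      using J that by (auto simp: norm_divide power_divide intro!: divide_right_mono power_mono)
    finally show ?thesis .
  qed
  have nz: "u + of_nat j \<noteq> 0" if "norm u \<le> R" for u :: complex
  proof
    assume "u + of_nat j = 0"
    then have "u = - of_nat j" by (simp add: eq_neg_iff_add_eq_0)
    then have "norm u = J" by (simp add: J_def)
    then show False using that J by simp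
  qed
  have rG: "rGamma (of_nat (Suc j) + u) = rGamma (of_nat j + u) / (u + of_nat j)" if "norm u \<le> R" for u :: complex
    using nz[OF that] rGamma_plus1[of "of_nat j + u"] by (simp add: field_simps)
  have "reg_term (Suc j) a b c d e f g = reg_term j a b c d e f g *
      ((a + of_nat j) * (b + of_nat j) * (c + of_nat j) * (d + of_nat j) *
       (1 / (e + of_nat j) * (1 / (f + of_nat j)) * (1 / (g + of_nat j)) / of_nat (Suc j)))"
    unfolding reg_term_def rG[OF R(6)] rG[OF R(7)] rG[OF R(8)] pochhammer_Suc
    by (simp add: mult_ac)
  then have "norm (reg_term (Suc j) a b c d e f g) = norm (reg_term j a b c d e f g) *
      (norm (a + of_nat j) * norm (b + of_nat j) * norm (c + of_nat j) * norm (d + of_nat j) *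
       (1 / norm (e + of_nat j) * (1 / norm (f + of_nat j)) * (1 / norm (g + of_nat j)) / real (Suc j)))"
    by (simp only: norm_mult norm_divide norm_one norm_of_nat)
  also have "\<dots> \<le> norm (reg_term j a b c d e f g) * (real j / real (Suc j)) powr (3 / 2)"
  proof (rule mult_left_mono)
    let ?u = "\<lambda>u. J * exp (Re u / J + R\<^sup>2 / 2 / J\<^sup>2)"
    let ?l = "\<lambda>u. 1 / J * exp (- (Re u / J) + 2 * R\<^sup>2 / J\<^sup>2)"
    have "norm (a + of_nat j) * norm (b + of_nat j) * norm (c + of_nat j) * norm (d + of_nat j) *
       (1 / norm (e + of_nat j) * (1 / norm (f + of_nat j)) * (1 / norm (g + of_nat j)) / real (Suc j)) \<le>
       ?u a * ?u b * ?u c * ?u d * (?l e * ?l f * ?l g / real (Suc j))"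
      using J by (intro mult_mono divide_right_mono up lo R) auto
    \<comment> \<open>Four numerator factors contribute \<open>1 / 2\<close> each and three
      denominator factors \<open>2\<close> each, hence the constant \<open>8\<close>. Of the powers
      of \<open>J\<close> one is left, to be paired with \<open>Suc j\<close> from the
      factorial.\<close>
    also have "\<dots> = J / real (Suc j) * exp ((Re (a + b + c + d) - Re (e + f + g)) / J + 8 * R\<^sup>2 / J\<^sup>2)"
    proof -
      have "?u a * ?u b * ?u c * ?u d * (?l e * ?l f * ?l g / real (Suc j)) =
        J / real (Suc j) * (exp (Re a / J + R\<^sup>2 / 2 / J\<^sup>2) * exp (Re b / J + R\<^sup>2 / 2 / J\<^sup>2) *
          exp (Re c / J + R\<^sup>2 / 2 / J\<^sup>2) * exp (Re d / J + R\<^sup>2 / 2 / J\<^sup>2) *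
          exp (- (Re e / J) + 2 * R\<^sup>2 / J\<^sup>2) * exp (- (Re f / J) + 2 * R\<^sup>2 / J\<^sup>2) *
          exp (- (Re g / J) + 2 * R\<^sup>2 / J\<^sup>2))"
        using J(2) by simp
      also have "\<dots> = J / real (Suc j) * exp ((Re (a + b + c + d) - Re (e + f + g)) / J + 8 * R\<^sup>2 / J\<^sup>2)"
        unfolding exp_add[symmetric]
        by (rule arg_cong[where f = "\<lambda>t. J / real (Suc j) * exp t"])
           (simp add: add_divide_distrib diff_divide_distrib)
      finally show ?thesis .
    qed
    also have "(Re (a + b + c + d) - Re (e + f + g)) = -1"
      using arg_cong[OF sum, of Re] by simp
    \<comment> \<open>Half of \<open>-1 / J\<close> pays for the error term; the other half is at
      most \<open>- (1 / 2) * ln (1 + 1 / J)\<close>. Together with \<open>J / real (Suc j)\<close>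
      this gives the exponent \<open>3 / 2\<close>.\<close>
    also have "J / real (Suc j) * exp (-1 / J + 8 * R\<^sup>2 / J\<^sup>2) \<le>
        J / real (Suc j) * exp (- (1 / 2) * ln (1 + 1 / J))"
    proof -
      have "8 * R\<^sup>2 / J\<^sup>2 \<le> 1 / 2 * (1 / J)"
        using J by (simp add: field_simps power2_eq_square)
      moreover have "ln (1 + 1 / J) \<le> 1 / J" using J by (intro ln_add_one_self_le_self) auto
      ultimately have "-1 / J + 8 * R\<^sup>2 / J\<^sup>2 \<le> - (1 / 2) * ln (1 + 1 / J)" by simp
      then show ?thesis using J by (intro mult_left_mono) auto
    qed
    also have "exp (- (1 / 2) * ln (1 + 1 / J)) = (J / real (Suc j)) powr (1 / 2)"
    proof -
      have "1 + 1 / J = real (Suc j) / J" using J by (simp add: J_def field_simps)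
      then have "ln (1 + 1 / J) = - ln (J / real (Suc j))" using J by (simp add: ln_div)
      then show ?thesis using J by (simp add: powr_def)
    qed
    also have "J / real (Suc j) * (J / real (Suc j)) powr (1 / 2) = (real j / real (Suc j)) powr (3 / 2)"
      using J by (subst powr_mult_base) (auto simp: J_def)
    finally show "norm (a + of_nat j) * norm (b + of_nat j) * norm (c + of_nat j) * norm (d + of_nat j) *
       (1 / norm (e + of_nat j) * (1 / norm (f + of_nat j)) * (1 / norm (g + of_nat j)) / real (Suc j)) \<le>
       (real j / real (Suc j)) powr (3 / 2)" .
  qed simp
  finally show ?thesis .
qed

text \<open>The ratio bounds telescope to \<open>(N / k) powr (3 / 2)\<close>. The starting index
  \<open>N\<close> depends on the parameters only through \<open>R\<close>, so the bound is uniform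
  on bounded parameter sets.\<close>

lemma reg_term_bound:
  fixes a b c d e f g :: complex and R :: real
  assumes sum: "e + f + g - a - b - c - d = 1"
    and R: "R \<ge> 1" "norm a \<le> R" "norm b \<le> R" "norm c \<le> R" "norm d \<le> R" "norm e \<le> R" "norm f \<le> R" "norm g \<le> R"
    and N: "real N \<ge> 16 * R\<^sup>2" and k: "k \<ge> N"
  shows "norm (reg_term k a b c d e f g) \<le>
         norm (reg_term N a b c d e f g) * real N powr (3 / 2) * real k powr (- (3 / 2))"
  using k
proof (induction k rule: dec_induct)
  case base
  have "real N > 0" using N R(1) by (smt (verit) one_le_power)
  then show ?case by (simp add: powr_minus field_simps)
next
  case (step j)
  have j: "real j \<ge> 16 * R\<^sup>2" "real j > 0" using N R(1) step.hyps(1)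
    by (smt (verit) of_nat_mono one_le_power)+
  have "norm (reg_term (Suc j) a b c d e f g) \<le>
         norm (reg_term j a b c d e f g) * (real j / real (Suc j)) powr (3 / 2)"
    by (rule reg_term_ratio[OF sum R j(1)])
  also have "\<dots> \<le> (norm (reg_term N a b c d e f g) * real N powr (3 / 2) * real j powr (- (3 / 2))) *
      (real j / real (Suc j)) powr (3 / 2)"
    by (intro mult_right_mono step.IH) auto
  also have "\<dots> = norm (reg_term N a b c d e f g) * real N powr (3 / 2) * real (Suc j) powr (- (3 / 2))"
    using j by (simp add: powr_divide powr_minus field_simps)
  finally show ?case .
qed

lemma summable_powr_three_halves: "summable (\<lambda>k. C * real k powr (- (3 / 2)))"
  by (intro summable_mult) (simp add: summable_real_powr_iff)

lemma summable_norm_reg_term: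
  fixes a b c d e f g :: complex
  assumes sum: "e + f + g - a - b - c - d = 1"
  shows "summable (\<lambda>k. norm (reg_term k a b c d e f g))"
proof -
  define R where "R = Max {1, norm a, norm b, norm c, norm d, norm e, norm f, norm g}"
  have R: "R \<ge> 1" "norm a \<le> R" "norm b \<le> R" "norm c \<le> R" "norm d \<le> R" "norm e \<le> R" "norm f \<le> R" "norm g \<le> R"
    unfolding R_def by (rule Max_ge; simp)+
  obtain N where N: "real N \<ge> 16 * R\<^sup>2" using real_arch_simple by blast
  show ?thesis
    by (rule summable_comparison_test'[OF summable_powr_three_halves, where N = N])
       (use reg_term_bound[OF sum R N] in simp)
qed

text \<open>Weierstrass M-test on closed unit discs: by compactness one \<open>R\<close>, hence one
  \<open>N\<close>, serves for the whole disc, and term \<open>N\<close> is bounded there. The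
  parameters are arbitrary entire functions subject to the Saalschuetz condition, so that a single
  coordinate can be varied later.\<close>

lemma holomorphic_reg_hyp4F3:
  fixes a b c d e f g :: "complex \<Rightarrow> complex"
  assumes hol: "a holomorphic_on UNIV" "b holomorphic_on UNIV" "c holomorphic_on UNIV" "d holomorphic_on UNIV"
      "e holomorphic_on UNIV" "f holomorphic_on UNIV" "g holomorphic_on UNIV"
    and sum: "\<And>z. e z + f z + g z - a z - b z - c z - d z = 1"
  shows "(\<lambda>z. reg_hyp4F3 (a z) (b z) (c z) (d z) (e z) (f z) (g z)) holomorphic_on UNIV"
proof (rule holomorphic_uniform_sequence)
  let ?t = "\<lambda>k z. reg_term k (a z) (b z) (c z) (d z) (e z) (f z) (g z)"
  have t_hol: "?t k holomorphic_on UNIV" for k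
    unfolding reg_term_def pochhammer_prod by (intro holomorphic_intros hol) auto
  show "(\<lambda>z. \<Sum>k<n. ?t k z) holomorphic_on UNIV" for n
    by (intro holomorphic_intros t_hol)
  fix x :: complex
  have bdd: "\<exists>B. \<forall>z\<in>cball x 1. norm (h z) \<le> B" if "h holomorphic_on UNIV" for h :: "complex \<Rightarrow> complex"
  proof -
    have "continuous_on (cball x 1) h"
      using that holomorphic_on_imp_continuous_on continuous_on_subset by blast
    then have "bounded (h ` cball x 1)"
      by (intro compact_imp_bounded compact_continuous_image) auto
    then show ?thesis by (auto simp: bounded_iff)
  qed
  obtain Ba Bb Bc Bd Be Bf Bg where B: "\<forall>z\<in>cball x 1. norm (a z) \<le> Ba" "\<forall>z\<in>cball x 1. norm (b z) \<le> Bb"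
    "\<forall>z\<in>cball x 1. norm (c z) \<le> Bc" "\<forall>z\<in>cball x 1. norm (d z) \<le> Bd" "\<forall>z\<in>cball x 1. norm (e z) \<le> Be"
    "\<forall>z\<in>cball x 1. norm (f z) \<le> Bf" "\<forall>z\<in>cball x 1. norm (g z) \<le> Bg"
    using bdd[OF hol(1)] bdd[OF hol(2)] bdd[OF hol(3)] bdd[OF hol(4)] bdd[OF hol(5)] bdd[OF hol(6)] bdd[OF hol(7)]
    by blast
  define R where "R = Max {1, Ba, Bb, Bc, Bd, Be, Bf, Bg}"
  have R1: "1 \<le> R" "Ba \<le> R" "Bb \<le> R" "Bc \<le> R" "Bd \<le> R" "Be \<le> R" "Bf \<le> R" "Bg \<le> R"
    unfolding R_def by (rule Max_ge; simp)+
  have R: "norm (a z) \<le> R" "norm (b z) \<le> R" "norm (c z) \<le> R" "norm (d z) \<le> R"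
    "norm (e z) \<le> R" "norm (f z) \<le> R" "norm (g z) \<le> R" if "z \<in> cball x 1" for z
    using bspec[OF B(1) that] bspec[OF B(2) that] bspec[OF B(3) that] bspec[OF B(4) that] bspec[OF B(5) that] bspec[OF B(6) that] bspec[OF B(7) that] R1 by linarith+
  obtain N where N: "real N \<ge> 16 * R\<^sup>2" using real_arch_simple by blast
  obtain C where C: "\<forall>z\<in>cball x 1. norm (?t N z) \<le> C" using bdd[OF t_hol] by blast
  have "uniform_limit (cball x 1) (\<lambda>n z. \<Sum>k<n. ?t k z) (\<lambda>z. \<Sum>k. ?t k z) sequentially"
  proof (rule Weierstrass_m_test_ev)
    have "norm (?t k z) \<le> (C * real N powr (3 / 2)) * real k powr (- (3 / 2))"
      if "k \<ge> N" "z \<in> cball x 1" for k z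
    proof -
      have "norm (?t k z) \<le> norm (?t N z) * real N powr (3 / 2) * real k powr (- (3 / 2))"
        by (rule reg_term_bound[OF sum R1(1) R[OF that(2)] N that(1)])
      also have "\<dots> \<le> C * real N powr (3 / 2) * real k powr (- (3 / 2))"
        using C that(2) by (intro mult_right_mono) auto
      finally show ?thesis .
    qed
    then show "\<forall>\<^sub>F k in sequentially. \<forall>z\<in>cball x 1. norm (?t k z) \<le>
        (C * real N powr (3 / 2)) * real k powr (- (3 / 2))"
      unfolding eventually_sequentially by blast
  qed (rule summable_powr_three_halves)
  then show "\<exists>r>0. cball x r \<subseteq> UNIV \<and> uniform_limit (cball x r) (\<lambda>n z. \<Sum>k<n. ?t k z)
      (\<lambda>z. reg_hyp4F3 (a z) (b z) (c z) (d z) (e z) (f z) (g z)) sequentially"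
    unfolding reg_hyp4F3_def reg_term_def by (intro exI[of _ 1]) auto
qed auto

text \<open>Termwise, \<open>Beta (b + k) a\<close> is \<open>Gamma b * Gamma a\<close> times
  \<open>pochhammer b k * rGamma (k + (b + a))\<close>. The hypothesis \<open>sum\<close> is the
  Saalschuetz condition for the lower parameters \<open>b1 + a1\<close>, \<open>b2 + a2\<close>,
  \<open>b3 + a3\<close>; it yields convergence, hence a real value \<open>F\<close>.\<close>

lemma reg_hyp4F3_Beta_series:
  fixes a a1 a2 a3 b1 b2 b3 :: real
  assumes pos: "a > 0" "a1 > 0" "a2 > 0" "a3 > 0" "b1 > 0" "b2 > 0" "b3 > 0" and sum: "a1 + a2 + a3 = a + 1"
  obtains F where "F \<ge> 0"
    "reg_hyp4F3 (of_real a) (of_real b1) (of_real b2) (of_real b3)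
       (of_real (b1 + a1)) (of_real (b2 + a2)) (of_real (b3 + a3)) = of_real F"
    "(\<Sum>k. ennreal (pochhammer a k / fact k) * ennreal (Beta (b1 + real k) a1 *
        Beta (b2 + real k) a2 * Beta (b3 + real k) a3)) =
     ennreal (Gamma b1 * Gamma b2 * Gamma b3 * (Gamma a1 * Gamma a2 * Gamma a3) * F)"
proof -
  define t where "t = (\<lambda>k. (pochhammer a k * pochhammer b1 k * pochhammer b2 k * pochhammer b3 k) / fact k *
          (rGamma (real k + (b1 + a1)) * rGamma (real k + (b2 + a2)) * rGamma (real k + (b3 + a3))))"
  have rG: "rGamma (of_nat k + complex_of_real x) = of_real (rGamma (real k + x))" for k x
    by (simp flip: rGamma_complex_of_real)
  have t: "reg_term k (of_real a) (of_real b1) (of_real b2) (of_real b3)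
       (of_real (b1 + a1)) (of_real (b2 + a2)) (of_real (b3 + a3)) = of_real (t k)" for k
    unfolding reg_term_def t_def rG pochhammer_of_real by simp
  have t0: "t k \<ge> 0" for k
    unfolding t_def using pos
    by (intro mult_nonneg_nonneg divide_nonneg_pos pochhammer_nonneg)
       (auto simp: rGamma_inverse_Gamma intro!: Gamma_real_nonneg)
  have "summable (\<lambda>k. norm (complex_of_real (t k)))"
    unfolding t[symmetric] by (rule summable_norm_reg_term) (use sum in \<open>simp flip: of_real_add of_real_diff\<close>)
  then have summ: "summable t" using t0 by simp
  have G: "Gamma x > 0" if "x > 0" for x :: real using that by (rule Gamma_real_pos)
  have G0: "Gamma x \<noteq> 0" if "x > 0" for x :: real using G[OF that] by auto
  have poch: "Gamma (x + real k) = Gamma x * pochhammer x k" if "x > 0" for x :: real and k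
    using that by (subst pochhammer_Gamma) (auto simp: G0 elim!: nonpos_Ints_cases)
  have B: "Beta (x + real k) y = Gamma x * Gamma y * (pochhammer x k * rGamma (real k + (x + y)))"
    if "x > 0" "y > 0" for x y :: real and k
    unfolding Beta_def poch[OF that(1)] by (simp add: rGamma_inverse_Gamma divide_inverse add_ac)
  define W where "W = Gamma b1 * Gamma b2 * Gamma b3 * (Gamma a1 * Gamma a2 * Gamma a3)"
  have W: "W \<ge> 0" unfolding W_def using pos by (intro mult_nonneg_nonneg Gamma_real_nonneg) auto
  have "ennreal (pochhammer a k / fact k) * ennreal (Beta (b1 + real k) a1 *
        Beta (b2 + real k) a2 * Beta (b3 + real k) a3) = ennreal (W * t k)" for k
  proof -
    have "pochhammer a k / fact k \<ge> 0"
      using pos by (intro divide_nonneg_pos pochhammer_nonneg) auto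
    moreover have "Beta (b1 + real k) a1 * Beta (b2 + real k) a2 * Beta (b3 + real k) a3 \<ge> 0"
      using pos by (intro mult_nonneg_nonneg Beta_real_nonneg) auto
    ultimately show ?thesis
      using pos by (simp only: ennreal_mult[symmetric]) (simp add: B W_def t_def mult_ac)
  qed
  then have "(\<Sum>k. ennreal (pochhammer a k / fact k) * ennreal (Beta (b1 + real k) a1 *
        Beta (b2 + real k) a2 * Beta (b3 + real k) a3)) = (\<Sum>k. ennreal (W * t k))" by simp
  also have "\<dots> = ennreal (\<Sum>k. W * t k)"
    using W t0 summ by (intro suminf_ennreal2 summable_mult) auto
  also have "(\<Sum>k. W * t k) = W * suminf t" using summ by (rule suminf_mult)
  finally have 1: "(\<Sum>k. ennreal (pochhammer a k / fact k) * ennreal (Beta (b1 + real k) a1 *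
        Beta (b2 + real k) a2 * Beta (b3 + real k) a3)) = ennreal (W * suminf t)" .
  have "reg_hyp4F3 (of_real a) (of_real b1) (of_real b2) (of_real b3)
       (of_real (b1 + a1)) (of_real (b2 + a2)) (of_real (b3 + a3)) = (\<Sum>k. of_real (t k))"
    unfolding reg_hyp4F3_def t[symmetric] reg_term_def ..
  also have "\<dots> = of_real (suminf t)" using summ by (rule suminf_of_real[symmetric])
  finally show thesis using 1 that[of "suminf t"] t0 summ unfolding W_def by (auto intro: suminf_nonneg)
qed

subsection \<open>Symmetry in the new coordinates\<close>

text \<open>\<open>K\<close> in the coordinates \<open>(y\<^sub>1, \<dots>, y\<^sub>6)\<close> given by the matrix \<open>S\<close>.\<close>

definition K6 :: "complex \<Rightarrow> complex \<Rightarrow> complex \<Rightarrow> complex \<Rightarrow> complex \<Rightarrow> complex \<Rightarrow> complex" where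
  "K6 y1 y2 y3 y4 y5 y6 = K_fun (y1 + y2 + y3 + y4 + y5 + y6 - 1) (y2 + y3) (y1 + y3) (y1 + y2)
     (y1 + y2 + y3 + y4) (y1 + y2 + y3 + y5) (y1 + y2 + y3 + y6)"

text \<open>In this form the second summand is the first with the blocks \<open>y1, y2, y3\<close>
  and \<open>y4, y5, y6\<close> interchanged.\<close>

lemma K6_altdef:
  "K6 y1 y2 y3 y4 y5 y6 =
     reg_hyp4F3 (y1 + y2 + y3 + y4 + y5 + y6 - 1) (y2 + y3) (y1 + y3) (y1 + y2)
       (y1 + y2 + y3 + y4) (y1 + y2 + y3 + y5) (y1 + y2 + y3 + y6) *
       (rGamma (y5 + y6) * rGamma (y4 + y6) * rGamma (y4 + y5)) +
     reg_hyp4F3 (y1 + y2 + y3 + y4 + y5 + y6 - 1) (y5 + y6) (y4 + y6) (y4 + y5)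
       (y1 + y4 + y5 + y6) (y2 + y4 + y5 + y6) (y3 + y4 + y5 + y6) *
       (rGamma (y2 + y3) * rGamma (y1 + y3) * rGamma (y1 + y2))"
proof -
  let ?a = "y1 + y2 + y3 + y4 + y5 + y6 - 1"
  have "1 + ?a - (y1 + y2 + y3 + y4) = y5 + y6" "1 + ?a - (y1 + y2 + y3 + y5) = y4 + y6"
    "1 + ?a - (y1 + y2 + y3 + y6) = y4 + y5" "1 + ?a - (y2 + y3) = y1 + y4 + y5 + y6"
    "1 + ?a - (y1 + y3) = y2 + y4 + y5 + y6" "1 + ?a - (y1 + y2) = y3 + y4 + y5 + y6"
    by simp_all
  then show ?thesis unfolding K6_def K_fun_def by (simp only:)
qed

lemma reg_hyp4F3_commute:
  "reg_hyp4F3 a c b d e f g = reg_hyp4F3 a b c d e f g"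
  "reg_hyp4F3 a b d c e f g = reg_hyp4F3 a b c d e f g"
  "reg_hyp4F3 a b c d f e g = reg_hyp4F3 a b c d e f g"
  "reg_hyp4F3 a b c d e g f = reg_hyp4F3 a b c d e f g"
  unfolding reg_hyp4F3_def by (simp_all only: mult_ac)

lemma K6_commute:
  "K6 y2 y1 y3 y4 y5 y6 = K6 y1 y2 y3 y4 y5 y6"
  "K6 y1 y3 y2 y4 y5 y6 = K6 y1 y2 y3 y4 y5 y6"
  "K6 y1 y2 y3 y5 y4 y6 = K6 y1 y2 y3 y4 y5 y6"
  "K6 y1 y2 y3 y4 y6 y5 = K6 y1 y2 y3 y4 y5 y6"
  unfolding K6_altdef
  by (simp_all only: add_ac mult_ac reg_hyp4F3_commute)

lemma holomorphic_K6:
  assumes "f1 holomorphic_on UNIV" "f2 holomorphic_on UNIV" "f3 holomorphic_on UNIV"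
    "f4 holomorphic_on UNIV" "f5 holomorphic_on UNIV" "f6 holomorphic_on UNIV"
  shows "(\<lambda>z. K6 (f1 z) (f2 z) (f3 z) (f4 z) (f5 z) (f6 z)) holomorphic_on UNIV"
  unfolding K6_altdef by (intro holomorphic_intros holomorphic_reg_hyp4F3 assms) (simp_all add: algebra_simps)

text \<open>The Beta series produce six Gamma factors each: three for pairs within one block and
  three for the pairs \<open>y1 + y4\<close>, \<open>y2 + y5\<close>, \<open>y3 + y6\<close>. The
  \<open>rGamma\<close> factors in \<open>K6\<close> account for the pairs within the other block,
  so both summands share one product of nine.\<close>

lemma K6_of_real:
  fixes y1 y2 y3 y4 y5 y6 :: real
  assumes y: "y1 > 0" "y2 > 0" "y3 > 0" "y4 > 0" "y5 > 0" "y6 > 0"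
    and a: "y1 + y2 + y3 + y4 + y5 + y6 > 1"
  obtains F where "F \<ge> 0" "K6 y1 y2 y3 y4 y5 y6 = of_real F"
    "cross_integral y1 y2 y3 y4 y5 y6 = ennreal
       (Gamma (y1 + y2) * Gamma (y1 + y3) * Gamma (y2 + y3) * Gamma (y4 + y5) * Gamma (y4 + y6) *
        Gamma (y5 + y6) * Gamma (y1 + y4) * Gamma (y2 + y5) * Gamma (y3 + y6) * F)"
proof -
  let ?a = "y1 + y2 + y3 + y4 + y5 + y6 - 1"
  have a': "?a > 0" using a by simp
  have sum: "(y3 + y6) + (y2 + y5) + (y1 + y4) = ?a + 1" by simp
  obtain F1 where F1: "F1 \<ge> 0"
    "reg_hyp4F3 (of_real ?a) (of_real (y1 + y2)) (of_real (y1 + y3)) (of_real (y2 + y3))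
       (of_real (y1 + y2 + (y3 + y6))) (of_real (y1 + y3 + (y2 + y5))) (of_real (y2 + y3 + (y1 + y4))) = of_real F1"
    "(\<Sum>k. ennreal (pochhammer ?a k / fact k) * ennreal (Beta (y1 + y2 + real k) (y3 + y6) *
        Beta (y1 + y3 + real k) (y2 + y5) * Beta (y2 + y3 + real k) (y1 + y4))) =
     ennreal (Gamma (y1 + y2) * Gamma (y1 + y3) * Gamma (y2 + y3) *
       (Gamma (y3 + y6) * Gamma (y2 + y5) * Gamma (y1 + y4)) * F1)"
    by (rule reg_hyp4F3_Beta_series[OF a' _ _ _ _ _ _ sum, of "y1 + y2" "y1 + y3" "y2 + y3"]) (use y in auto)
  obtain F2 where F2: "F2 \<ge> 0"
    "reg_hyp4F3 (of_real ?a) (of_real (y4 + y5)) (of_real (y4 + y6)) (of_real (y5 + y6))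
       (of_real (y4 + y5 + (y3 + y6))) (of_real (y4 + y6 + (y2 + y5))) (of_real (y5 + y6 + (y1 + y4))) = of_real F2"
    "(\<Sum>k. ennreal (pochhammer ?a k / fact k) * ennreal (Beta (y4 + y5 + real k) (y3 + y6) *
        Beta (y4 + y6 + real k) (y2 + y5) * Beta (y5 + y6 + real k) (y1 + y4))) =
     ennreal (Gamma (y4 + y5) * Gamma (y4 + y6) * Gamma (y5 + y6) *
       (Gamma (y3 + y6) * Gamma (y2 + y5) * Gamma (y1 + y4)) * F2)"
    by (rule reg_hyp4F3_Beta_series[OF a' _ _ _ _ _ _ sum, of "y4 + y5" "y4 + y6" "y5 + y6"]) (use y in auto)
  define F where "F = F1 * (rGamma (y5 + y6) * rGamma (y4 + y6) * rGamma (y4 + y5)) +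
     F2 * (rGamma (y2 + y3) * rGamma (y1 + y3) * rGamma (y1 + y2))"
  \<comment> \<open>The Beta chains list the parameters in the order opposite to that of
    \<open>K6_altdef\<close>.\<close>
  have rev: "reg_hyp4F3 p b c d e f g = reg_hyp4F3 p d c b g f e" for p b c d e f g
    by (metis reg_hyp4F3_commute)
  have "reg_hyp4F3 (of_real y1 + of_real y2 + of_real y3 + of_real y4 + of_real y5 + of_real y6 - 1)
      (of_real y2 + of_real y3) (of_real y1 + of_real y3) (of_real y1 + of_real y2)
      (of_real y1 + of_real y2 + of_real y3 + of_real y4) (of_real y1 + of_real y2 + of_real y3 + of_real y5)
      (of_real y1 + of_real y2 + of_real y3 + of_real y6) = of_real F1"
    using F1(2) by (subst rev) (simp add: add_ac)
  moreover have "reg_hyp4F3 (of_real y1 + of_real y2 + of_real y3 + of_real y4 + of_real y5 + of_real y6 - 1)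
      (of_real y5 + of_real y6) (of_real y4 + of_real y6) (of_real y4 + of_real y5)
      (of_real y1 + of_real y4 + of_real y5 + of_real y6) (of_real y2 + of_real y4 + of_real y5 + of_real y6)
      (of_real y3 + of_real y4 + of_real y5 + of_real y6) = of_real F2"
    using F2(2) by (subst rev) (simp add: add_ac)
  moreover have rG: "rGamma (of_real x + complex_of_real z) = of_real (rGamma (x + z))" for x z
    by (simp flip: rGamma_complex_of_real)
  ultimately have 1: "K6 y1 y2 y3 y4 y5 y6 = of_real F"
    unfolding K6_altdef F_def rG by simp
  have rpos: "rGamma x \<ge> 0" if "x > 0" for x :: real
    using Gamma_real_pos[OF that] by (simp add: rGamma_inverse_Gamma)
  have F0: "F \<ge> 0"
    unfolding F_def using F1(1) F2(1) y by (intro add_nonneg_nonneg mult_nonneg_nonneg rpos) auto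
  have G: "Gamma x \<ge> 0" "Gamma x * rGamma x = 1" if "x > 0" for x :: real
  proof -
    have "Gamma x > 0" using that by (rule Gamma_real_pos)
    then show "Gamma x \<ge> 0" "Gamma x * rGamma x = 1"
      by (auto simp: rGamma_inverse_Gamma less_imp_neq[symmetric])
  qed
  have "cross_integral y1 y2 y3 y4 y5 y6 =
     ennreal (Gamma (y1 + y2) * Gamma (y1 + y3) * Gamma (y2 + y3) *
       (Gamma (y3 + y6) * Gamma (y2 + y5) * Gamma (y1 + y4)) * F1) +
     ennreal (Gamma (y4 + y5) * Gamma (y4 + y6) * Gamma (y5 + y6) *
       (Gamma (y3 + y6) * Gamma (y2 + y5) * Gamma (y1 + y4)) * F2)"
    using cross_integral_eq_sums[OF y a'] F1(3) F2(3) by simp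
  also have "\<dots> = ennreal (Gamma (y1 + y2) * Gamma (y1 + y3) * Gamma (y2 + y3) *
       (Gamma (y3 + y6) * Gamma (y2 + y5) * Gamma (y1 + y4)) * F1 +
     Gamma (y4 + y5) * Gamma (y4 + y6) * Gamma (y5 + y6) *
       (Gamma (y3 + y6) * Gamma (y2 + y5) * Gamma (y1 + y4)) * F2)"
    using y F1(1) F2(1) by (intro ennreal_plus[symmetric] mult_nonneg_nonneg G) auto
  also have "Gamma (y1 + y2) * Gamma (y1 + y3) * Gamma (y2 + y3) *
       (Gamma (y3 + y6) * Gamma (y2 + y5) * Gamma (y1 + y4)) * F1 +
     Gamma (y4 + y5) * Gamma (y4 + y6) * Gamma (y5 + y6) *
       (Gamma (y3 + y6) * Gamma (y2 + y5) * Gamma (y1 + y4)) * F2 =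
     (Gamma (y1 + y2) * Gamma (y1 + y3) * Gamma (y2 + y3) * Gamma (y4 + y5) * Gamma (y4 + y6) *
        Gamma (y5 + y6) * Gamma (y1 + y4) * Gamma (y2 + y5) * Gamma (y3 + y6) * F)" (is "?l = ?r")
  proof -
    \<comment> \<open>Each series is multiplied by three factors
      \<open>Gamma x * rGamma x = 1\<close> for the pairs within the block that it lacks.\<close>
    have "?r = Gamma (y1 + y2) * Gamma (y1 + y3) * Gamma (y2 + y3) *
       (Gamma (y3 + y6) * Gamma (y2 + y5) * Gamma (y1 + y4)) * F1 *
       ((Gamma (y5 + y6) * rGamma (y5 + y6)) * (Gamma (y4 + y6) * rGamma (y4 + y6)) * (Gamma (y4 + y5) * rGamma (y4 + y5))) +
     Gamma (y4 + y5) * Gamma (y4 + y6) * Gamma (y5 + y6) *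
       (Gamma (y3 + y6) * Gamma (y2 + y5) * Gamma (y1 + y4)) * F2 *
       ((Gamma (y2 + y3) * rGamma (y2 + y3)) * (Gamma (y1 + y3) * rGamma (y1 + y3)) * (Gamma (y1 + y2) * rGamma (y1 + y2)))"
      unfolding F_def by (simp only: ring_distribs mult_ac)
    then show ?thesis using y by (simp add: G(2))
  qed
  finally show thesis using that F0 1 by blast
qed

text \<open>The prefactors of \<open>cross_integral_swap\<close> together with the nine Gamma
  factors give the same positive product \<open>W\<close> on both sides, so it cancels.\<close>

lemma K6_swap_of_real:
  fixes y1 y2 y3 y4 y5 y6 :: real
  assumes y: "y1 > 1" "y2 > 1" "y3 > 1" "y4 > 1" "y5 > 1" "y6 > 1"
  shows "K6 y1 y2 y3 y4 y5 y6 = K6 y1 y5 y3 y4 y2 y6"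
proof -
  have y0: "y1 > 0" "y2 > 0" "y3 > 0" "y4 > 0" "y5 > 0" "y6 > 0" using y by auto
  obtain F where F: "F \<ge> 0" "K6 y1 y2 y3 y4 y5 y6 = of_real F"
    "cross_integral y1 y2 y3 y4 y5 y6 = ennreal
       (Gamma (y1 + y2) * Gamma (y1 + y3) * Gamma (y2 + y3) * Gamma (y4 + y5) * Gamma (y4 + y6) *
        Gamma (y5 + y6) * Gamma (y1 + y4) * Gamma (y2 + y5) * Gamma (y3 + y6) * F)"
    by (rule K6_of_real[of y1 y2 y3 y4 y5 y6]) (use y in auto)
  obtain F' where F': "F' \<ge> 0" "K6 y1 y5 y3 y4 y2 y6 = of_real F'"
    "cross_integral y1 y5 y3 y4 y2 y6 = ennreal
       (Gamma (y1 + y5) * Gamma (y1 + y3) * Gamma (y5 + y3) * Gamma (y4 + y2) * Gamma (y4 + y6) *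
        Gamma (y2 + y6) * Gamma (y1 + y4) * Gamma (y5 + y2) * Gamma (y3 + y6) * F')"
    by (rule K6_of_real[of y1 y5 y3 y4 y2 y6]) (use y in auto)
  define W where "W = (Gamma (y1 + y5) * Gamma (y2 + y6) * (Gamma (y2 + y4) * Gamma (y3 + y5))) *
    ((Gamma (y1 + y2) * Gamma (y5 + y6) * (Gamma (y4 + y5) * Gamma (y2 + y3))) *
     (Gamma (y1 + y3) * Gamma (y4 + y6) * Gamma (y1 + y4) * Gamma (y2 + y5) * Gamma (y3 + y6)))"
  have W: "W > 0" unfolding W_def using y0 by (intro mult_pos_pos Gamma_real_pos) auto
  have l: "ennreal (Gamma (y1 + y5) * Gamma (y2 + y6) * (Gamma (y2 + y4) * Gamma (y3 + y5))) *
           cross_integral y1 y2 y3 y4 y5 y6 = ennreal (W * F)"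
    unfolding F(3) using y0 F(1)
    by (subst ennreal_mult[symmetric]) (auto intro!: mult_nonneg_nonneg Gamma_real_nonneg simp: W_def mult_ac)
  have r: "ennreal (Gamma (y1 + y2) * Gamma (y5 + y6) * (Gamma (y4 + y5) * Gamma (y2 + y3))) *
           cross_integral y1 y5 y3 y4 y2 y6 = ennreal (W * F')"
    unfolding F'(3) using y0 F'(1)
    by (subst ennreal_mult[symmetric]) (auto intro!: mult_nonneg_nonneg Gamma_real_nonneg simp: W_def mult_ac add_ac)
  have "W * F = W * F'"
    using cross_integral_swap[OF y0] W F(1) F'(1) unfolding l r by simp
  then show ?thesis using F(2) F'(2) W by simp
qed

text \<open>Identity theorem: the zeros accumulate at \<open>2\<close>, as the sequence
  \<open>2 + 1 / (n + 1)\<close> shows.\<close>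

lemma holomorphic_zero_extend:
  fixes f :: "complex \<Rightarrow> complex"
  assumes "f holomorphic_on UNIV" "\<And>t::real. t > 1 \<Longrightarrow> f (of_real t) = 0"
  shows "f z = 0"
proof (rule analytic_continuation[OF assms(1), of "of_real ` {1<..}" 2])
  show "(2::complex) islimpt of_real ` {1<..}"
  proof (rule islimpt_sequential[THEN iffD2], intro exI conjI allI)
    show "complex_of_real (2 + 1 / real (Suc n)) \<in> of_real ` {1<..} - {2}" for n
    proof -
      have "complex_of_real (2 + 1 / real (Suc n)) \<noteq> of_real 2" unfolding of_real_eq_iff by simp
      moreover have "2 + 1 / real (Suc n) \<in> {1<..}" by (simp add: add_pos_pos)
      ultimately show ?thesis by (metis DiffI imageI of_real_numeral singletonD)
    qed
    have "(\<lambda>n. 2 + 1 / real (Suc n)) \<longlonglongrightarrow> 2 + 0"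
      by (intro tendsto_intros LIMSEQ_Suc[OF lim_1_over_n])
    from tendsto_of_real[OF this, where 'a = complex]
    show "(\<lambda>n. complex_of_real (2 + 1 / real (Suc n))) \<longlonglongrightarrow> 2" by simp
  qed
qed (use assms in auto)

text \<open>The arguments are freed from left to right. At each stage those to the left are
  arbitrary complex numbers, those to the right are reals above \<open>1\<close>, and the identity
  theorem in one variable applies to the argument between them.\<close>

lemma K6_swap: "K6 y1 y2 y3 y4 y5 y6 = K6 y1 y5 y3 y4 y2 y6"
proof -
  define D where "D = (\<lambda>y1 y2 y3 y4 y5 y6. K6 y1 y2 y3 y4 y5 y6 - K6 y1 y5 y3 y4 y2 y6)"
  note hol = holomorphic_on_diff holomorphic_K6 holomorphic_on_ident holomorphic_on_const
  have 0: "D (of_real t1) (of_real t2) (of_real t3) (of_real t4) (of_real t5) (of_real t6) = 0"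
    if "t1 > 1" "t2 > 1" "t3 > 1" "t4 > 1" "t5 > 1" "t6 > 1" for t1 t2 t3 t4 t5 t6 :: real
    using K6_swap_of_real[OF that] by (simp add: D_def)
  have 1: "D z1 (of_real t2) (of_real t3) (of_real t4) (of_real t5) (of_real t6) = 0"
    if "t2 > 1" "t3 > 1" "t4 > 1" "t5 > 1" "t6 > 1" for z1 and t2 t3 t4 t5 t6 :: real
    by (rule holomorphic_zero_extend[of "\<lambda>z. D z t2 t3 t4 t5 t6"])
       (use 0 that in \<open>auto simp: D_def intro!: hol\<close>)
  have 2: "D z1 z2 (of_real t3) (of_real t4) (of_real t5) (of_real t6) = 0"
    if "t3 > 1" "t4 > 1" "t5 > 1" "t6 > 1" for z1 z2 and t3 t4 t5 t6 :: real
    by (rule holomorphic_zero_extend[of "\<lambda>z. D z1 z t3 t4 t5 t6"])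
       (use 1 that in \<open>auto simp: D_def intro!: hol\<close>)
  have 3: "D z1 z2 z3 (of_real t4) (of_real t5) (of_real t6) = 0"
    if "t4 > 1" "t5 > 1" "t6 > 1" for z1 z2 z3 and t4 t5 t6 :: real
    by (rule holomorphic_zero_extend[of "\<lambda>z. D z1 z2 z t4 t5 t6"])
       (use 2 that in \<open>auto simp: D_def intro!: hol\<close>)
  have 4: "D z1 z2 z3 z4 (of_real t5) (of_real t6) = 0"
    if "t5 > 1" "t6 > 1" for z1 z2 z3 z4 and t5 t6 :: real
    by (rule holomorphic_zero_extend[of "\<lambda>z. D z1 z2 z3 z t5 t6"])
       (use 3 that in \<open>auto simp: D_def intro!: hol\<close>)
  have 5: "D z1 z2 z3 z4 z5 (of_real t6) = 0" if "t6 > 1" for z1 z2 z3 z4 z5 and t6 :: real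
    by (rule holomorphic_zero_extend[of "\<lambda>z. D z1 z2 z3 z4 z t6"])
       (use 4 that in \<open>auto simp: D_def intro!: hol\<close>)
  have "D y1 y2 y3 y4 y5 y6 = 0"
    by (rule holomorphic_zero_extend[of "\<lambda>z. D y1 y2 y3 y4 y5 z"])
       (use 5 in \<open>auto simp: D_def intro!: hol\<close>)
  then show ?thesis by (simp add: D_def)
qed

subsection \<open>The group action\<close>

lemma exhaust_6: fixes x :: 6 shows "x = 1 \<or> x = 2 \<or> x = 3 \<or> x = 4 \<or> x = 5 \<or> x = 6"
proof (induct x)
  case (of_int z)
  \<comment> \<open>The representatives start at \<open>0\<close>, which is the same element of the
    type as \<open>6\<close>.\<close>
  then have "z = 0 \<or> z = 1 \<or> z = 2 \<or> z = 3 \<or> z = 4 \<or> z = 5" by fastforce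
  then show ?case by auto
qed

lemma exhaust_7: fixes x :: 7 shows "x = 1 \<or> x = 2 \<or> x = 3 \<or> x = 4 \<or> x = 5 \<or> x = 6 \<or> x = 7"
proof (induct x)
  case (of_int z)
  then have "z = 0 \<or> z = 1 \<or> z = 2 \<or> z = 3 \<or> z = 4 \<or> z = 5 \<or> z = 6" by fastforce
  then show ?case by auto
qed

lemma forall_7: "(\<forall>i::7. P i) \<longleftrightarrow> P 1 \<and> P 2 \<and> P 3 \<and> P 4 \<and> P 5 \<and> P 6 \<and> P 7"
  by (metis exhaust_7)

lemma sum_6: "sum f (UNIV :: 6 set) = f 1 + f 2 + f 3 + f 4 + f 5 + f 6"
proof -
  have UNIV: "(UNIV :: 6 set) = {1, 2, 3, 4, 5, 6}" using exhaust_6 by auto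
  show ?thesis unfolding UNIV by (simp add: ac_simps)
qed

lemma sum_7: "sum f (UNIV :: 7 set) = f 1 + f 2 + f 3 + f 4 + f 5 + f 6 + f 7"
proof -
  have UNIV: "(UNIV :: 7 set) = {1, 2, 3, 4, 5, 6, 7}" using exhaust_7 by auto
  show ?thesis unfolding UNIV by (simp add: ac_simps)
qed

lemma vector_6:
  "(vector [a, b, c, d, e, f] :: 'a::zero ^ 6) $ 1 = a" "(vector [a, b, c, d, e, f] :: 'a::zero ^ 6) $ 2 = b"
  "(vector [a, b, c, d, e, f] :: 'a::zero ^ 6) $ 3 = c" "(vector [a, b, c, d, e, f] :: 'a::zero ^ 6) $ 4 = d"
  "(vector [a, b, c, d, e, f] :: 'a::zero ^ 6) $ 5 = e" "(vector [a, b, c, d, e, f] :: 'a::zero ^ 6) $ 6 = f"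
  unfolding vector_def by simp_all

lemma vector_7:
  "(vector [a, b, c, d, e, f, g] :: 'a::zero ^ 7) $ 1 = a" "(vector [a, b, c, d, e, f, g] :: 'a::zero ^ 7) $ 2 = b"
  "(vector [a, b, c, d, e, f, g] :: 'a::zero ^ 7) $ 3 = c" "(vector [a, b, c, d, e, f, g] :: 'a::zero ^ 7) $ 4 = d"
  "(vector [a, b, c, d, e, f, g] :: 'a::zero ^ 7) $ 5 = e" "(vector [a, b, c, d, e, f, g] :: 'a::zero ^ 7) $ 6 = f"
  "(vector [a, b, c, d, e, f, g] :: 'a::zero ^ 7) $ 7 = g"
  unfolding vector_def by simp_all

section \<open>Invariance under all permutations of six arguments\<close>

definition K6_fun :: "(6 \<Rightarrow> complex) \<Rightarrow> complex" where
  "K6_fun y = K6 (y 1) (y 2) (y 3) (y 4) (y 5) (y 6)"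

text \<open>The pairs whose transposition leaves \<open>K6_fun\<close> invariant form an equivalence
  relation; transitivity is conjugation, \<open>(i j) (j k) (i j) = (i k)\<close>. The adjacent
  pairs inside the two blocks and the link between \<open>2\<close> and \<open>5\<close> connect all
  six indices.\<close>

lemma K6_fun_transpose:
  "K6_fun (y \<circ> Transposition.transpose i j) = K6_fun y"
proof -
  define R where "R = (\<lambda>i j :: 6. \<forall>y. K6_fun (y \<circ> Transposition.transpose i j) = K6_fun y)"
  have adjacent: "R 1 2" "R 2 3" "R 4 5" "R 5 6"
    unfolding R_def K6_fun_def by (simp_all add: Transposition.transpose_def K6_commute)
  have cross: "R 2 5"
    unfolding R_def K6_fun_def by (simp add: Transposition.transpose_def) (metis K6_swap)
  have refl: "R i i" for i by (simp add: R_def)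
  have sym: "R j i" if "R i j" for i j
    using that by (simp add: R_def transpose_commute)
  have trans: "R i k" if "R i j" "R j k" for i j k
  proof (cases "i = k \<or> j = k")
    case True
    then show ?thesis using that refl by auto
  next
    case False
    then have "Transposition.transpose i j \<circ> Transposition.transpose j k \<circ> Transposition.transpose i j =
        Transposition.transpose i k" by (intro transpose_comp_triple) auto
    then show ?thesis using that unfolding R_def by (metis comp_assoc)
  qed
  have "R 1 j" for j
    using exhaust_6[of j] refl sym trans adjacent cross by metis
  then have "R i j" using sym trans by blast
  then show ?thesis by (simp add: R_def)
qed

lemma K6_fun_permutes:
  assumes "\<sigma> permutes (UNIV :: 6 set)"
  shows "K6_fun (y \<circ> \<sigma>) = K6_fun y"
  using assms finite
proof (induction \<sigma> arbitrary: y rule: permutes_induct)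
  case (swap a b p)
  then show ?case using K6_fun_transpose by (metis comp_assoc)
qed simp

section \<open>The matrix action and the coordinate change by \<open>S_mat\<close>\<close>

lemma act_mult: "act (A ** B) x = act A (act B x)"
proof -
  have "map_matrix complex_of_real (A ** B) = map_matrix complex_of_real A ** map_matrix complex_of_real B"
    by (simp add: map_matrix_def matrix_matrix_mult_def vec_eq_iff)
  then show ?thesis by (simp add: act_def matrix_vector_mul_assoc)
qed

lemma act_mat_1: "act (mat 1) x = x"
proof -
  have "map_matrix complex_of_real (mat 1) = (mat 1 :: complex ^ 7 ^ 7)"
    by (simp add: map_matrix_def mat_def vec_eq_iff)
  then show ?thesis by (simp add: act_def)
qed

lemma act_nth: "act A x $ i = (\<Sum>j\<in>UNIV. of_real (A $ i $ j) * x $ j)"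
  by (simp add: act_def matrix_vector_mult_def map_matrix_def)

lemma S_mat_matrix_inv: "S_mat ** matrix_inv S_mat = mat 1"
proof -
  \<comment> \<open>Solving \<open>b = y2 + y3\<close>, \<open>c = y1 + y3\<close>,
    \<open>d = y1 + y2\<close> gives the rows with \<open>1/2\<close>; since
    \<open>y1 + y2 + y3 = (b + c + d) / 2\<close>, the last three rows subtract this half sum from
    \<open>e\<close>, \<open>f\<close>, \<open>g\<close>.\<close>
  define T :: "real ^ 7 ^ 7" where "T = vector
    [vector [1, 0, 0, 0, 0, 0, 0],
     vector [0, -1/2, 1/2, 1/2, 0, 0, 0],
     vector [0, 1/2, -1/2, 1/2, 0, 0, 0],
     vector [0, 1/2, 1/2, -1/2, 0, 0, 0],
     vector [0, -1/2, -1/2, -1/2, 1, 0, 0],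
     vector [0, -1/2, -1/2, -1/2, 0, 1, 0],
     vector [0, -1/2, -1/2, -1/2, 0, 0, 1]]"
  have "S_mat ** T = mat 1"
    unfolding vec_eq_iff forall_7 matrix_matrix_mult_def mat_def
    by (simp add: sum_7 S_mat_def T_def vector_7)
  then have "S_mat ** T = mat 1 \<and> T ** S_mat = mat 1" using matrix_left_right_inverse by blast
  \<comment> \<open>\<open>matrix_inv\<close> chooses some two-sided inverse, so the existence of
    one suffices.\<close>
  then show ?thesis unfolding matrix_inv_def by (rule someI2) simp
qed

lemma act_S_mat:
  "act S_mat y $ 1 = y $ 1" "act S_mat y $ 2 = y $ 3 + y $ 4" "act S_mat y $ 3 = y $ 2 + y $ 4"
  "act S_mat y $ 4 = y $ 2 + y $ 3" "act S_mat y $ 5 = y $ 2 + y $ 3 + y $ 4 + y $ 5"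
  "act S_mat y $ 6 = y $ 2 + y $ 3 + y $ 4 + y $ 6" "act S_mat y $ 7 = y $ 2 + y $ 3 + y $ 4 + y $ 7"
  by (simp_all add: act_nth sum_7 S_mat_def vector_7)

lemma K_vec_act_S_mat:
  assumes "y $ 1 = y $ 2 + y $ 3 + y $ 4 + y $ 5 + y $ 6 + y $ 7 - 1"
  shows "K_vec (act S_mat y) = K6 (y $ 2) (y $ 3) (y $ 4) (y $ 5) (y $ 6) (y $ 7)"
  unfolding K_vec_def act_S_mat K6_def assms ..

theorem proposition3p3:
  fixes x :: "complex ^ 7" and h :: "real ^ 7 ^ 7"
  assumes "x \<in> V7" and "h \<in> G_K"
  shows "K_vec (act h x) = K_vec x"
proof -
  obtain \<sigma> :: "6 \<Rightarrow> 6" and q where \<sigma>: "\<sigma> permutes UNIV" and q: "q = (\<chi> i j. if i = \<sigma> j then 1 else 0)"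
    and h: "h = S_mat ** block1 q ** matrix_inv S_mat"
    using assms(2) unfolding G_K_def P16_def Q6_def by blast
  define y where "y = act (matrix_inv S_mat) x"
  have x: "x = act S_mat y"
    unfolding y_def act_mult[symmetric] S_mat_matrix_inv act_mat_1 ..
  have hx: "act h x = act S_mat (act (block1 q) y)"
    unfolding h y_def by (simp only: act_mult)
  define u :: "complex ^ 6" where "u = vector [y $ 2, y $ 3, y $ 4, y $ 5, y $ 6, y $ 7]"
  have u: "u $ 1 = y $ 2" "u $ 2 = y $ 3" "u $ 3 = y $ 4" "u $ 4 = y $ 5" "u $ 5 = y $ 6" "u $ 6 = y $ 7"
    by (simp_all add: u_def vector_6)
  have inv: "inv \<sigma> permutes UNIV" using \<sigma> by (rule permutes_inv)
  \<comment> \<open>Column \<open>j\<close> of \<open>q\<close> has its \<open>1\<close> in row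
    \<open>\<sigma> j\<close>, so position \<open>i\<close> receives the coordinate with index
    \<open>inv \<sigma> i\<close>.\<close>
  have qu: "(\<Sum>j\<in>UNIV. of_real (q $ i $ j) * u $ j) = u $ inv \<sigma> i" for i
  proof -
    have "(\<Sum>j\<in>UNIV. of_real (q $ i $ j) * u $ j) = (\<Sum>j\<in>UNIV. if inv \<sigma> i = j then u $ j else 0)"
      using permutes_inv_eq[OF \<sigma>] by (intro sum.cong) (auto simp: q)
    then show ?thesis by simp
  qed
  define z where "z = act (block1 q) y"
  have z1: "z $ 1 = y $ 1"
    by (simp add: z_def act_nth sum_7 block1_def vector_7)
  have z: "z $ 2 = u $ inv \<sigma> 1" "z $ 3 = u $ inv \<sigma> 2" "z $ 4 = u $ inv \<sigma> 3"
      "z $ 5 = u $ inv \<sigma> 4" "z $ 6 = u $ inv \<sigma> 5" "z $ 7 = u $ inv \<sigma> 6"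
    unfolding qu[symmetric] z_def by (simp_all add: act_nth sum_6 sum_7 block1_def vector_7 u)
  \<comment> \<open>In the new coordinates the equation of \<open>V7\<close> collapses to this: the
    sum of the first block occurs three times in \<open>e + f + g\<close> and twice in
    \<open>b + c + d\<close>.\<close>
  have y1: "y $ 1 = y $ 2 + y $ 3 + y $ 4 + y $ 5 + y $ 6 + y $ 7 - 1"
    using assms(1) unfolding V7_def mem_Collect_eq x act_S_mat by (simp add: algebra_simps)
  \<comment> \<open>The block matrix fixes the first coordinate and permutes the others, so their
    sum is unchanged and the image satisfies the same equation.\<close>
  have "(\<Sum>i\<in>UNIV. u $ inv \<sigma> i) = (\<Sum>i\<in>UNIV. u $ i)"
    using sum.permute[OF inv, of "\<lambda>i. u $ i"] by (simp add: o_def)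
  then have z1': "z $ 1 = z $ 2 + z $ 3 + z $ 4 + z $ 5 + z $ 6 + z $ 7 - 1"
    unfolding z1 y1 z by (simp add: sum_6 u)
  have "K_vec (act h x) = K6_fun ((\<lambda>i. u $ i) \<circ> inv \<sigma>)"
    unfolding hx z_def[symmetric] K_vec_act_S_mat[OF z1'] by (simp add: z K6_fun_def)
  also have "\<dots> = K6_fun (\<lambda>i. u $ i)" by (rule K6_fun_permutes[OF inv])
  also have "\<dots> = K_vec x"
    unfolding x K_vec_act_S_mat[OF y1] by (simp add: u K6_fun_def)
  finally show ?thesis .
qed

end
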